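(* Let $-\infty\le a<b\le\infty$ and let $\varrho,\varsigma,\chi$ be locally finite complex Borel measures on $(a,b)$ with $\operatorname{supp}(\varsigma)=(a,b)$. Fix $g\in L^1_{loc}((a,b);|\varrho|)$. Then for every $z\in\mathbb{C}$, $c\in(a,b)$ and $d_1,d_2\in\mathbb{C}$ there is a unique $u\in\mathfrak{D}_\tau$ with $(\tau-z)u=g$ (i.e. $\tau u-zu=g$ $|\varrho|$-a.e.), $u(c)=d_1$ and $u^{[1]}(c)=d_2$, if and only if $$\varrho(\{x\})\varsigma(\{x\})=0\quad\text{and}\quad \chi(\{x\})\varsigma(\{x\})\neq 1\qquad\text{for all }x\in(a,b).$$ If, in addition, the measures $\varrho,\varsigma,\chi$ are real-valued and $g$, $d_1$, $d_2$ and $z$ are real, then this solution is real-valued.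
   Context: For a locally finite complex Borel measure $\mu$ on $(a,b)$, $c,x\in(a,b)$ and $h\in L^1_{loc}((a,b);|\mu|)$ one sets $\int_c^x h\,d\mu=\int_{[c,x)}h\,d\mu$ if $x>c$, $=0$ if $x=c$, and $=-\int_{[x,c)}h\,d\mu$ if $x<c$. $AC_{loc}((a,b);\mu)$ is the set of functions $f(x)=f(c)+\int_c^x h\,d\mu$, $x\in(a,b)$, with $h\in L^1_{loc}((a,b);|\mu|)$; $h=\frac{df}{d\mu}$ is its Radon–Nikodym derivative. $\mathfrak{D}_\tau$ is the set of $f\in AC_{loc}((a,b);\varsigma)$ for which there is a function $F\in AC_{loc}((a,b);\varrho)$ with $F(x)=-\frac{df}{d\varsigma}(x)+\int_c^x f\,d\chi$ for $|\varsigma|$-a.e. $x$ (for some, hence all, $c\in(a,b)$); $F$ is unique since $\operatorname{supp}\varsigma=(a,b)$, and one defines $\tau f:=\frac{dF}{d\varrho}\in L^1_{loc}((a,b);|\varrho|)$ and the quasi-derivative $f^{[1]}(x):=\int_c^x f\,d\chi-F(x)$ (a pointwise representative of $\frac{df}{d\varsigma}$). *)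

theory Defs
  imports "HOL-Analysis.Analysis"
begin

text \<open>
  A locally finite complex Borel measure on the interval (a,b) is represented by its polar
  decomposition: a pair (M, h) where M (= the variation measure) is a positive Borel measure
  on the reals, concentrated on (a,b) and finite on compact subsets of (a,b), and h is a
  Borel density with modulus one; the complex measure is then A \<mapsto> integral of h over A
  with respect to M.
\<close>

type_synonym cmeas = "real measure \<times> (real \<Rightarrow> complex)"

definition ival :: "ereal \<Rightarrow> ereal \<Rightarrow> real set" where
  "ival a b = {x. a < ereal x \<and> ereal x < b}"

abbreviation var :: "cmeas \<Rightarrow> real measure" where "var \<mu> \<equiv> fst \<mu>"
abbreviation dens :: "cmeas \<Rightarrow> real \<Rightarrow> complex" where "dens \<mu> \<equiv> snd \<mu>"

definition loc_finite_cmeasure :: "ereal \<Rightarrow> ereal \<Rightarrow> cmeas \<Rightarrow> bool" where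
  "loc_finite_cmeasure a b \<mu> \<longleftrightarrow>
     sets (var \<mu>) = sets borel \<and>
     emeasure (var \<mu>) (UNIV - ival a b) = 0 \<and>
     (\<forall>K. compact K \<and> K \<subseteq> ival a b \<longrightarrow> emeasure (var \<mu>) K < \<infinity>) \<and>
     dens \<mu> \<in> borel_measurable borel \<and>
     (\<forall>x. cmod (dens \<mu> x) = 1)"

definition cmeasure :: "cmeas \<Rightarrow> real set \<Rightarrow> complex" where
  "cmeasure \<mu> A = set_lebesgue_integral (var \<mu>) A (dens \<mu>)"

definition full_support :: "ereal \<Rightarrow> ereal \<Rightarrow> cmeas \<Rightarrow> bool" where
  "full_support a b \<mu> \<longleftrightarrow>
     (\<forall>x\<in>ival a b. \<forall>e>0. emeasure (var \<mu>) {x - e<..<x + e} > 0)"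

definition real_cmeasure :: "ereal \<Rightarrow> ereal \<Rightarrow> cmeas \<Rightarrow> bool" where
  "real_cmeasure a b \<mu> \<longleftrightarrow>
     (\<forall>K A. compact K \<and> K \<subseteq> ival a b \<and> A \<in> sets borel \<and> A \<subseteq> K
        \<longrightarrow> cmeasure \<mu> A \<in> \<real>)"

definition L1loc :: "ereal \<Rightarrow> ereal \<Rightarrow> cmeas \<Rightarrow> (real \<Rightarrow> complex) \<Rightarrow> bool" where
  "L1loc a b \<mu> f \<longleftrightarrow>
     (\<forall>K. compact K \<and> K \<subseteq> ival a b \<longrightarrow> set_integrable (var \<mu>) K f)"

definition cint :: "cmeas \<Rightarrow> real \<Rightarrow> real \<Rightarrow> (real \<Rightarrow> complex) \<Rightarrow> complex" where
  "cint \<mu> c x f =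
     (if c < x then set_lebesgue_integral (var \<mu>) {c..<x} (\<lambda>t. f t * dens \<mu> t)
      else if x = c then 0
      else - set_lebesgue_integral (var \<mu>) {x..<c} (\<lambda>t. f t * dens \<mu> t))"

text \<open>f \<in> AC_loc((a,b);\<mu>) with Radon--Nikodym derivative h (base point c).\<close>
definition AC_with :: "ereal \<Rightarrow> ereal \<Rightarrow> cmeas \<Rightarrow> real \<Rightarrow> (real \<Rightarrow> complex) \<Rightarrow> (real \<Rightarrow> complex) \<Rightarrow> bool" where
  "AC_with a b \<mu> c f h \<longleftrightarrow>
     L1loc a b \<mu> h \<and> (\<forall>x\<in>ival a b. f x = f c + cint \<mu> c x h)"

text \<open>u \<in> D_tau, witnessed by the function F (base point c), with \<tau>u = k.\<close>
definition Dtau_rep :: "ereal \<Rightarrow> ereal \<Rightarrow> cmeas \<Rightarrow> cmeas \<Rightarrow> cmeas \<Rightarrow> real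
    \<Rightarrow> (real \<Rightarrow> complex) \<Rightarrow> (real \<Rightarrow> complex) \<Rightarrow> (real \<Rightarrow> complex) \<Rightarrow> bool" where
  "Dtau_rep a b \<rho> \<sigma> \<kappa> c u F k \<longleftrightarrow>
     (\<exists>h. AC_with a b \<sigma> c u h \<and> AC_with a b \<rho> c F k \<and>
          (AE x in var \<sigma>. x \<in> ival a b \<longrightarrow> F x = - h x + cint \<kappa> c x u))"

text \<open>u solves (\<tau> - z) u = g with u(c) = d1 and u^[1](c) = d2.\<close>
definition ivp_solution :: "ereal \<Rightarrow> ereal \<Rightarrow> cmeas \<Rightarrow> cmeas \<Rightarrow> cmeas \<Rightarrow> (real \<Rightarrow> complex)
    \<Rightarrow> complex \<Rightarrow> real \<Rightarrow> complex \<Rightarrow> complex \<Rightarrow> (real \<Rightarrow> complex) \<Rightarrow> bool" where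
  "ivp_solution a b \<rho> \<sigma> \<kappa> g z c d1 d2 u \<longleftrightarrow>
     (\<exists>F k. Dtau_rep a b \<rho> \<sigma> \<kappa> c u F k \<and>
        (AE x in var \<rho>. x \<in> ival a b \<longrightarrow> k x - z * u x = g x) \<and>
        u c = d1 \<and> cint \<kappa> c c u - F c = d2)"

end

theory Submission
  imports Defs
begin

text \<open>
  With the quasi-derivative \<open>w = u\<^bsup>[1]\<^esup>\<close> the equation \<open>(\<tau> - z) u = g\<close> becomes the first order system
  \<open>du = w d\<sigma>\<close>, \<open>dw = u d\<kappa> - (z u + g) d\<rho>\<close> for the left-continuous pair \<open>(u, w)\<close>. Passing a point \<open>x\<close>
  applies an affine jump map whose linear part has determinant
  \<open>1 - \<sigma>{x} (\<kappa>{x} - z \<rho>{x})\<close>; this is nonzero for every \<open>z\<close> exactly under the stated condition.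
  Around each point \<open>p\<close> the total variations of the punctured neighbourhoods are small, so on both sides of
  \<open>p\<close> the system is a contraction in the supremum norm, and crossing \<open>p\<close> from right to left only
  requires inverting the jump. Bolzano's bisection principle turns these local statements
  into existence and uniqueness on compact intervals. Conversely, if the jump at \<open>x\<close> is singular,
  two solutions with different values at \<open>x\<close> coincide immediately to the right of \<open>x\<close>, which
  contradicts uniqueness for a base point there. Reality holds since complex conjugation preserves the
  initial value problem.
\<close>

section \<open>Contractions in the supremum norm\<close>

text \<open>Picard iteration started at \<open>f0\<close>. The admissible class is a predicate
  \<open>G\<close> closed under uniform limits on \<open>S\<close>, so that measurability survives
  the limit. The fixed point equation is claimed on \<open>S\<close> only, because the supremum norm
  gives no control elsewhere.\<close>

lemma contraction_fixed_point:
  fixes T :: "('a \<Rightarrow> 'b::banach) \<Rightarrow> 'a \<Rightarrow> 'b"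
  assumes G0: "G f0"
    and step: "\<And>f. G f \<Longrightarrow> G (T f)"
    and bdd: "\<And>f. G f \<Longrightarrow> bounded (f ` S)"
    and lim: "\<And>fs f. (\<And>n. G (fs n)) \<Longrightarrow> uniform_limit S fs f sequentially \<Longrightarrow> G f"
    and contr: "\<And>f h C x. G f \<Longrightarrow> G h \<Longrightarrow> (\<And>x. x \<in> S \<Longrightarrow> norm (f x - h x) \<le> C) \<Longrightarrow> x \<in> S
      \<Longrightarrow> norm (T f x - T h x) \<le> C / 2"
  obtains f where "G f" "\<And>x. x \<in> S \<Longrightarrow> T f x = f x"
proof -
  define fs where "fs n = (T ^^ n) f0" for n
  have Gfs: "G (fs n)" for n
    by (induction n) (auto simp: fs_def G0 step)
  have fs_Suc: "fs (Suc n) = T (fs n)" for n by (simp add: fs_def)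
  obtain B0 B1 where B: "\<And>x. x \<in> S \<Longrightarrow> norm (fs 0 x) \<le> B0" "\<And>x. x \<in> S \<Longrightarrow> norm (fs 1 x) \<le> B1"
    using bdd[OF Gfs[of 0]] bdd[OF Gfs[of 1]] unfolding bounded_iff by blast
  have diff: "norm (fs (Suc n) x - fs n x) \<le> (B1 + B0) * (1/2) ^ n" if "x \<in> S" for n x
    using that
  proof (induction n arbitrary: x)
    case 0
    then show ?case
      using norm_triangle_ineq4[of "fs 1 x" "fs 0 x"] B(1)[of x] B(2)[of x] by simp
  next
    case (Suc n)
    have "norm (T (fs (Suc n)) x - T (fs n) x) \<le> (B1 + B0) * (1/2) ^ n / 2"
      by (rule contr[OF Gfs Gfs Suc.IH Suc.prems])
    then show ?case by (simp add: fs_Suc)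
  qed
  \<comment> \<open>The limit is written as a telescoping series, so that the geometric bound
    \<open>diff\<close> yields uniform convergence by the Weierstrass test.\<close>
  define f where "f x = fs 0 x + (\<Sum>i. fs (Suc i) x - fs i x)" for x
  have "uniform_limit S (\<lambda>n x. \<Sum>i<n. fs (Suc i) x - fs i x) (\<lambda>x. \<Sum>i. fs (Suc i) x - fs i x) sequentially"
    by (rule Weierstrass_m_test[OF diff]) auto
  then have "uniform_limit S (\<lambda>n x. fs 0 x + (\<Sum>i<n. fs (Suc i) x - fs i x)) f sequentially"
    unfolding f_def by (intro uniform_limit_add uniform_limit_const)
  moreover have "(\<lambda>n x. fs 0 x + (\<Sum>i<n. fs (Suc i) x - fs i x)) = fs"
  proof (intro ext)
    fix n x
    show "fs 0 x + (\<Sum>i<n. fs (Suc i) x - fs i x) = fs n x"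
      by (induction n) (auto simp: algebra_simps)
  qed
  ultimately have ul: "uniform_limit S fs f sequentially" by simp
  then have Gf: "G f" using lim Gfs by blast
  have "T f x = f x" if x: "x \<in> S" for x
  proof -
    \<comment> \<open>\<open>T f\<close> is close to \<open>T (fs N)\<close> by contraction, and
      \<open>T (fs N)\<close>, being the next iterate, is close to \<open>f\<close>.\<close>
    have "norm (T f x - f x) \<le> e" if e: "e > 0" for e
    proof -
      have "\<forall>\<^sub>F n in sequentially. \<forall>x\<in>S. dist (fs n x) (f x) < e / 2"
        using ul e unfolding uniform_limit_iff by (meson half_gt_zero)
      then obtain N where N: "\<And>n x. n \<ge> N \<Longrightarrow> x \<in> S \<Longrightarrow> dist (fs n x) (f x) < e / 2"
        unfolding eventually_sequentially by blast
      have "norm (T f x - T (fs N) x) \<le> (e/2)/2"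
        by (rule contr[OF Gf Gfs _ x])
          (use N[of N] in \<open>simp add: dist_norm norm_minus_commute less_imp_le\<close>)
      moreover have "norm (T (fs N) x - f x) < e / 2"
        using N[of "Suc N" x] x by (simp add: dist_norm fs_Suc)
      ultimately show ?thesis
        using norm_triangle_ineq[of "T f x - T (fs N) x" "T (fs N) x - f x"] e by simp
    qed
    then have "norm (T f x - f x) \<le> 0" by (rule field_le_epsilon) simp
    then show ?thesis by simp
  qed
  with Gf show thesis by (rule that)
qed

text \<open>The difference of two fixed points is bounded, and every application of
  \<open>contr\<close> halves the bound. Having \<open>contr\<close> for an arbitrary bound
  \<open>C\<close> avoids suprema.\<close>

lemma contraction_fixed_point_unique:
  fixes T :: "('a \<Rightarrow> 'b::real_normed_vector) \<Rightarrow> 'a \<Rightarrow> 'b"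
  assumes bdd: "\<And>f. G f \<Longrightarrow> bounded (f ` S)"
    and contr: "\<And>f h C x. G f \<Longrightarrow> G h \<Longrightarrow> (\<And>x. x \<in> S \<Longrightarrow> norm (f x - h x) \<le> C) \<Longrightarrow> x \<in> S
      \<Longrightarrow> norm (T f x - T h x) \<le> C / 2"
    and f: "G f" "\<And>x. x \<in> S \<Longrightarrow> T f x = f x"
    and h: "G h" "\<And>x. x \<in> S \<Longrightarrow> T h x = h x"
    and x: "x \<in> S"
  shows "f x = h x"
proof -
  obtain B0 B1 where B: "\<And>x. x \<in> S \<Longrightarrow> norm (f x) \<le> B0" "\<And>x. x \<in> S \<Longrightarrow> norm (h x) \<le> B1"
    using bdd[OF f(1)] bdd[OF h(1)] unfolding bounded_iff by blast
  have "norm (f x - h x) \<le> (B0 + B1) * (1/2) ^ n" if "x \<in> S" for n x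
    using that
  proof (induction n arbitrary: x)
    case 0
    then show ?case using norm_triangle_ineq4[of "f x" "h x"] B(1)[of x] B(2)[of x] by simp
  next
    case (Suc n)
    have "norm (T f x - T h x) \<le> (B0 + B1) * (1/2) ^ n / 2"
      by (rule contr[OF f(1) h(1) Suc.IH Suc.prems])
    then show ?case using Suc.prems f h by simp
  qed
  moreover have "(\<lambda>n. (B0 + B1) * (1/2) ^ n) \<longlonglongrightarrow> 0"
    by (intro tendsto_mult_right_zero LIMSEQ_power_zero) auto
  ultimately have "norm (f x - h x) \<le> 0"
    using x by (intro Lim_bounded2[of _ 0]) auto
  then show ?thesis by simp
qed

section \<open>Integration against locally finite complex measures\<close>

lemma ival_Icc_subset: "x \<in> ival a b \<Longrightarrow> y \<in> ival a b \<Longrightarrow> {x..y} \<subseteq> ival a b"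
proof
  fix t assume "x \<in> ival a b" "y \<in> ival a b" "t \<in> {x..y}"
  then have "a < ereal x" "ereal x \<le> ereal t" "ereal t \<le> ereal y" "ereal y < b"
    by (auto simp: ival_def)
  then show "t \<in> ival a b"
    unfolding ival_def mem_Collect_eq by (meson less_le_trans le_less_trans)
qed

lemma open_ival: "open (ival a b)"
proof -
  have "ival a b = ereal -` {a<..<b}" by (auto simp: ival_def)
  then show ?thesis by (simp add: open_vimage continuous_on_ereal)
qed

lemma ival_ball:
  assumes "x \<in> ival a b"
  obtains d where "d > 0" "{x - d..x + d} \<subseteq> ival a b"
  using open_ival[of a b] assms that unfolding open_contains_cball cball_eq_atLeastAtMost by blast

text \<open>Local integrability is tested on compact sets, whereas the estimates below live on
  intervals. Adding \<open>c\<close> to \<open>K\<close> covers the case of empty \<open>K\<close>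
  and places \<open>c\<close> between the endpoints.\<close>

lemma ival_compact_Icc:
  assumes "compact K" "K \<subseteq> ival a b" "c \<in> ival a b"
  obtains \<alpha> \<beta> where "\<alpha> \<in> ival a b" "\<beta> \<in> ival a b" "\<alpha> \<le> c" "c \<le> \<beta>" "K \<subseteq> {\<alpha>..\<beta>}"
proof -
  have K: "compact (insert c K)" "insert c K \<noteq> {}" using assms by auto
  obtain \<alpha> where "\<alpha> \<in> insert c K" "\<forall>t\<in>insert c K. \<alpha> \<le> t" using compact_attains_inf[OF K] by blast
  moreover obtain \<beta> where "\<beta> \<in> insert c K" "\<forall>t\<in>insert c K. t \<le> \<beta>"
    using compact_attains_sup[OF K] by blast
  ultimately show thesis using that assms by (metis atLeastAtMost_iff insert_iff subsetD subsetI)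
qed

text \<open>Only values on \<open>S\<close> matter, since a solution is determined on a given
  interval only. Boundedness makes such functions integrable on compact subintervals for all three
  measures at once.\<close>

definition bmeas :: "real set \<Rightarrow> (real \<Rightarrow> complex) \<Rightarrow> bool" where
  "bmeas S f \<longleftrightarrow> set_borel_measurable borel S f \<and> bounded (f ` S)"

lemma bmeas_subset: "bmeas S f \<Longrightarrow> T \<subseteq> S \<Longrightarrow> T \<in> sets borel \<Longrightarrow> bmeas T f"
  unfolding bmeas_def
  by (meson bounded_subset image_mono set_borel_measurable_subset)

lemma bmeas_cong: "bmeas S f \<Longrightarrow> (\<And>t. t \<in> S \<Longrightarrow> f t = h t) \<Longrightarrow> bmeas S h"
proof -
  assume f: "bmeas S f" and eq: "\<And>t. t \<in> S \<Longrightarrow> f t = h t"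
  have "f ` S = h ` S" using eq by force
  moreover have "(\<lambda>t. indicator S t *\<^sub>R f t) = (\<lambda>t. indicator S t *\<^sub>R h t)"
    using eq by (intro ext) (simp add: indicator_def, blast)
  ultimately show ?thesis using f unfolding bmeas_def set_borel_measurable_def by simp
qed

lemma bmeas_const: "S \<in> sets borel \<Longrightarrow> bmeas S (\<lambda>t. c)"
  unfolding bmeas_def set_borel_measurable_def by (auto intro!: finite_imp_bounded finite_subset[of _ "{c}"])

lemma bmeas_add: "bmeas S f \<Longrightarrow> bmeas S h \<Longrightarrow> bmeas S (\<lambda>t. f t + h t)"
  unfolding bmeas_def set_borel_measurable_def
  by (auto simp: scaleR_add_right intro!: bounded_plus_comp)

lemma bmeas_cmult: "bmeas S f \<Longrightarrow> bmeas S (\<lambda>t. c * f t)"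
proof -
  assume f: "bmeas S f"
  have "(\<lambda>t. c * (indicator S t *\<^sub>R f t)) \<in> borel_measurable borel"
    using f unfolding bmeas_def set_borel_measurable_def
    by (intro borel_measurable_times borel_measurable_const) blast
  moreover have "bounded ((\<lambda>x. c * x) ` (f ` S))"
    by (rule bounded_linear_image[OF _ bounded_linear_mult_right]) (use f in \<open>simp add: bmeas_def\<close>)
  moreover have "(\<lambda>t. c * (indicator S t *\<^sub>R f t)) = (\<lambda>t. indicator S t *\<^sub>R (c * f t))"
    by simp
  ultimately show ?thesis
    unfolding bmeas_def set_borel_measurable_def by (simp only: image_image)
qed

lemma bmeas_diff: "bmeas S f \<Longrightarrow> bmeas S h \<Longrightarrow> bmeas S (\<lambda>t. f t - h t)"
  using bmeas_add[of S f "\<lambda>t. (-1) * h t"] bmeas_cmult[of S h "-1"] by simp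

lemma bmeas_Un:
  assumes "bmeas S f" "bmeas T f" "S \<in> sets borel" "T \<in> sets borel"
  shows "bmeas (S \<union> T) f"
proof -
  have [measurable]: "(\<lambda>t. indicator S t *\<^sub>R f t) \<in> borel_measurable borel"
    "(\<lambda>t. indicator T t *\<^sub>R f t) \<in> borel_measurable borel" "S \<in> sets borel"
    using assms unfolding bmeas_def set_borel_measurable_def by auto
  have "(\<lambda>t. indicator S t *\<^sub>R f t + indicator (- S) t *\<^sub>R (indicator T t *\<^sub>R f t))
      \<in> borel_measurable borel" by measurable
  moreover have "(\<lambda>t. indicator S t *\<^sub>R f t + indicator (- S) t *\<^sub>R (indicator T t *\<^sub>R f t))
      = (\<lambda>t. indicator (S \<union> T) t *\<^sub>R f t)"
    by (auto simp: indicator_def)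
  ultimately show ?thesis
    using assms unfolding bmeas_def set_borel_measurable_def by (auto simp: image_Un)
qed

lemma bmeas_uniform_limit:
  assumes fs: "\<And>n. bmeas S (fs n)" and ul: "uniform_limit S fs f sequentially"
  shows "bmeas S f"
proof -
  have "(\<lambda>t. indicator S t *\<^sub>R f t) \<in> borel_measurable borel"
  proof (rule borel_measurable_LIMSEQ_metric)
    show "(\<lambda>t. indicator S t *\<^sub>R fs n t) \<in> borel_measurable borel" for n
      using fs[of n] unfolding bmeas_def set_borel_measurable_def by simp
    show "(\<lambda>n. indicator S t *\<^sub>R fs n t) \<longlonglongrightarrow> indicator S t *\<^sub>R f t" for t
      using tendsto_uniform_limitI[OF ul, of t] by (cases "t \<in> S") auto
  qed
  moreover have "bounded (f ` S)"
  proof -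
    have "\<forall>\<^sub>F n in sequentially. \<forall>x\<in>S. dist (fs n x) (f x) < 1"
      using ul unfolding uniform_limit_iff by simp
    then obtain n where n: "\<And>x. x \<in> S \<Longrightarrow> dist (fs n x) (f x) < 1"
      unfolding eventually_sequentially by blast
    obtain B where B: "\<And>x. x \<in> S \<Longrightarrow> norm (fs n x) \<le> B"
      using fs[of n] unfolding bmeas_def bounded_iff by blast
    have "norm (f x) \<le> B + 1" if "x \<in> S" for x
      using n[OF that] B[OF that] norm_triangle_ineq2[of "f x" "fs n x"]
      by (simp add: dist_norm norm_minus_commute)
    then show ?thesis unfolding bounded_iff by blast
  qed
  ultimately show ?thesis unfolding bmeas_def set_borel_measurable_def by simp
qed

section \<open>Integrals against one locally finite complex measure\<close>

definition cmint :: "cmeas \<Rightarrow> real set \<Rightarrow> (real \<Rightarrow> complex) \<Rightarrow> complex" where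
  "cmint \<mu> A f = set_lebesgue_integral (var \<mu>) A (\<lambda>t. f t * dens \<mu> t)"

lemma cmint_empty [simp]: "cmint \<mu> {} f = 0"
  by (simp add: cmint_def set_lebesgue_integral_def)

lemma cmint_cong: "(\<And>t. t \<in> A \<Longrightarrow> f t = h t) \<Longrightarrow> cmint \<mu> A f = cmint \<mu> A h"
  unfolding cmint_def set_lebesgue_integral_def
  by (intro Bochner_Integration.integral_cong) (auto simp: indicator_def)

lemma cmint_singleton: "cmint \<mu> {x} f = f x * cmeasure \<mu> {x}"
proof -
  have "cmint \<mu> {x} f = cmint \<mu> {x} (\<lambda>_. f x)" by (rule cmint_cong) simp
  then show ?thesis by (simp add: cmint_def cmeasure_def)
qed

text \<open>For \<open>x = c\<close> the interval of integration is empty, so the three cases of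
  \<open>cint\<close> collapse to two.\<close>

lemma cint_eq_cmint: "cint \<mu> c x f = (if c \<le> x then cmint \<mu> {c..<x} f else - cmint \<mu> {x..<c} f)"
  by (auto simp: cint_def cmint_def set_lebesgue_integral_def)

locale loc_finite =
  fixes a b :: ereal and \<mu> :: cmeas
  assumes loc_finite: "loc_finite_cmeasure a b \<mu>"
begin

lemma sets_var [simp, measurable_cong]: "sets (var \<mu>) = sets borel"
  using loc_finite unfolding loc_finite_cmeasure_def by blast

lemma dens_measurable [measurable]: "dens \<mu> \<in> borel_measurable borel"
  using loc_finite unfolding loc_finite_cmeasure_def by blast

lemma norm_dens [simp]: "norm (dens \<mu> x) = 1"
  using loc_finite unfolding loc_finite_cmeasure_def by blast

lemma emeasure_finite:
  assumes "\<alpha> \<in> ival a b" "\<beta> \<in> ival a b" "A \<subseteq> {\<alpha>..\<beta>}"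
  shows "emeasure (var \<mu>) A < \<infinity>"
proof -
  have "emeasure (var \<mu>) {\<alpha>..\<beta>} < \<infinity>"
    using loc_finite ival_Icc_subset[OF assms(1,2)] unfolding loc_finite_cmeasure_def by blast
  then show ?thesis
    using emeasure_mono[OF assms(3), of "var \<mu>"] by (simp add: le_less_trans)
qed

lemma measurable_var_iff: "f \<in> borel_measurable (var \<mu>) \<longleftrightarrow> f \<in> borel_measurable borel"
  by (simp add: measurable_def sets_eq_imp_space_eq[OF sets_var])

lemma set_integrable_dens:
  assumes "set_integrable (var \<mu>) A f"
  shows "set_integrable (var \<mu>) A (\<lambda>t. f t * dens \<mu> t)"
proof -
  have f: "integrable (var \<mu>) (\<lambda>x. indicator A x *\<^sub>R f x)"
    using assms by (simp add: set_integrable_def)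
  have "integrable (var \<mu>) (\<lambda>x. (indicator A x *\<^sub>R f x) * dens \<mu> x)"
  proof (rule Bochner_Integration.integrable_bound[OF f])
    show "(\<lambda>x. (indicator A x *\<^sub>R f x) * dens \<mu> x) \<in> borel_measurable (var \<mu>)"
      using borel_measurable_integrable[OF f] dens_measurable
      unfolding measurable_var_iff by (rule borel_measurable_times)
  qed (auto simp: norm_mult)
  then show ?thesis by (simp add: set_integrable_def)
qed

lemma bmeas_set_integrable:
  assumes f: "bmeas S f" and S: "S \<subseteq> {\<alpha>..\<beta>}" "\<alpha> \<in> ival a b" "\<beta> \<in> ival a b" "S \<in> sets borel"
  shows "set_integrable (var \<mu>) S f"
proof -
  obtain B where B: "\<And>t. t \<in> S \<Longrightarrow> norm (f t) \<le> B"
    using f unfolding bmeas_def bounded_iff by blast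
  have "integrable (var \<mu>) (\<lambda>t. indicator S t *\<^sub>R B)"
    using emeasure_finite[OF S(2,3,1)] S(4) by (simp add: integrable_mult_indicator )
  then show ?thesis
    unfolding set_integrable_def
  proof (rule Bochner_Integration.integrable_bound)
    show "(\<lambda>t. indicator S t *\<^sub>R f t) \<in> borel_measurable (var \<mu>)"
      using f by (simp add: measurable_var_iff bmeas_def set_borel_measurable_def)
    show "AE t in var \<mu>. norm (indicator S t *\<^sub>R f t) \<le> norm (indicator S t *\<^sub>R B)"
    proof (rule AE_I2)
      fix t show "norm (indicator S t *\<^sub>R f t) \<le> norm (indicator S t *\<^sub>R B)"
        using B[of t] by (cases "t \<in> S") auto
    qed
  qed
qed

lemma cmint_Un:
  assumes "A \<inter> B = {}" "set_integrable (var \<mu>) A f" "set_integrable (var \<mu>) B f"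
  shows "cmint \<mu> (A \<union> B) f = cmint \<mu> A f + cmint \<mu> B f"
  unfolding cmint_def using assms by (intro set_integral_Un set_integrable_dens)

lemma cmint_diff:
  assumes "set_integrable (var \<mu>) A f" "set_integrable (var \<mu>) A h"
  shows "cmint \<mu> A (\<lambda>t. f t - h t) = cmint \<mu> A f - cmint \<mu> A h"
  unfolding cmint_def left_diff_distrib using assms by (intro set_integral_diff set_integrable_dens)

lemma norm_cmint_le:
  assumes f: "set_integrable (var \<mu>) A f" and A: "A \<in> sets borel" "emeasure (var \<mu>) A < \<infinity>"
    and le: "\<And>t. t \<in> A \<Longrightarrow> norm (f t) \<le> C"
  shows "norm (cmint \<mu> A f) \<le> C * measure (var \<mu>) A"
proof -
  have "norm (cmint \<mu> A f) \<le> (\<integral>t. norm (indicator A t *\<^sub>R (f t * dens \<mu> t)) \<partial>var \<mu>)"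
    unfolding cmint_def set_lebesgue_integral_def by (rule integral_norm_bound)
  also have "\<dots> \<le> (\<integral>t. indicator A t *\<^sub>R C \<partial>var \<mu>)"
  proof (rule integral_mono)
    show "integrable (var \<mu>) (\<lambda>t. norm (indicator A t *\<^sub>R (f t * dens \<mu> t)))"
      using set_integrable_dens[OF f] unfolding set_integrable_def by (rule integrable_norm)
    show "integrable (var \<mu>) (\<lambda>t. indicator A t *\<^sub>R C)"
      using A by simp
    show "norm (indicator A t *\<^sub>R (f t * dens \<mu> t)) \<le> indicator A t *\<^sub>R C" for t
      using le[of t] by (cases "t \<in> A") (auto simp: norm_mult)
  qed
  also have "\<dots> = C * measure (var \<mu>) A"
    using A by simp
  finally show ?thesis .
qed

lemma norm_cmint_le_integral:
  assumes f: "set_integrable (var \<mu>) K f" and A: "A \<subseteq> K" "A \<in> sets borel"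
  shows "norm (cmint \<mu> A f) \<le> (\<integral>t. norm (indicator K t *\<^sub>R f t) \<partial>var \<mu>)"
proof -
  have fA: "set_integrable (var \<mu>) A f"
    using set_integrable_subset[OF f _ A(1)] A(2) by simp
  have "norm (cmint \<mu> A f) \<le> (\<integral>t. norm (indicator A t *\<^sub>R (f t * dens \<mu> t)) \<partial>var \<mu>)"
    unfolding cmint_def set_lebesgue_integral_def by (rule integral_norm_bound)
  also have "\<dots> \<le> (\<integral>t. norm (indicator K t *\<^sub>R f t) \<partial>var \<mu>)"
  proof (rule integral_mono)
    show "integrable (var \<mu>) (\<lambda>t. norm (indicator A t *\<^sub>R (f t * dens \<mu> t)))"
      using set_integrable_dens[OF fA] unfolding set_integrable_def by (rule integrable_norm)
    show "integrable (var \<mu>) (\<lambda>t. norm (indicator K t *\<^sub>R f t))"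
      using f unfolding set_integrable_def by (rule integrable_norm)
    show "norm (indicator A t *\<^sub>R (f t * dens \<mu> t)) \<le> norm (indicator K t *\<^sub>R f t)" for t
      using A by (auto simp: norm_mult indicator_def)
  qed
  finally show ?thesis .
qed

text \<open>Measurability in the parameter is the measurability part of Fubini's theorem, for which
  the sets \<open>A t\<close> have to be the sections of one product-measurable set. Boundedness
  follows from the integral of \<open>norm f\<close> over \<open>K\<close>.\<close>

lemma bmeas_cmint:
  assumes f: "set_integrable (var \<mu>) K f" and K: "K \<in> sets borel" "emeasure (var \<mu>) K < \<infinity>"
    and A: "{p. fst p \<in> A (snd p)} \<in> sets (borel \<Otimes>\<^sub>M borel)" "\<And>t. A t \<subseteq> K"
    and S: "S \<in> sets borel"
  shows "bmeas S (\<lambda>t. cmint \<mu> (A t) f)"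
proof -
  note [measurable] = K(1) A(1)
  \<comment> \<open>Cutting \<open>var \<mu>\<close> off outside \<open>K\<close> gives a finite
    measure, to which the Fubini argument applies.\<close>
  define M where "M = density (var \<mu>) (\<lambda>t. ennreal (indicator K t))"
  have sM [measurable_cong]: "sets M = sets borel" by (simp add: M_def)
  have "finite_measure M"
  proof
    have "space M = UNIV" using sets_eq_imp_space_eq[OF sM] by simp
    then show "emeasure M (space M) \<noteq> \<infinity>"
      using K by (simp add: M_def emeasure_density ennreal_indicator)
  qed
  then interpret M: finite_measure M .
  \<comment> \<open>Measurability of \<open>f\<close> is known only after restriction to
    \<open>K\<close>, hence the indicator.\<close>
  define F where "F t = (indicator K t *\<^sub>R f t) * dens \<mu> t" for t
  have [measurable]: "F \<in> borel_measurable borel"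
    using f set_integrable_dens[OF f] borel_measurable_integrable
    unfolding F_def set_integrable_def measurable_var_iff[symmetric] by auto
  have ind: "(\<lambda>p. indicator (A (fst p)) (snd p) :: real) \<in> borel_measurable (borel \<Otimes>\<^sub>M borel)"
  proof -
    have "(\<lambda>p. indicator {p. fst p \<in> A (snd p)} (snd p, fst p) :: real)
      \<in> borel_measurable (borel \<Otimes>\<^sub>M borel)" by measurable
    moreover have "(\<lambda>p. indicator {p. fst p \<in> A (snd p)} (snd p, fst p) :: real)
      = (\<lambda>p. indicator (A (fst p)) (snd p))" by (auto simp: indicator_def)
    ultimately show ?thesis by simp
  qed
  have "(\<lambda>t. \<integral>s. indicator (A t) s *\<^sub>R F s \<partial>M) \<in> borel_measurable borel"
  proof (rule M.borel_measurable_lebesgue_integral)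
    have "(\<lambda>p. indicator (A (fst p)) (snd p) *\<^sub>R F (snd p)) \<in> borel_measurable (borel \<Otimes>\<^sub>M M)"
      using ind by measurable
    then show "(\<lambda>(t, s). indicator (A t) s *\<^sub>R F s) \<in> borel_measurable (borel \<Otimes>\<^sub>M M)"
      by (simp add: case_prod_unfold)
  qed
  moreover have "(\<integral>s. indicator (A t) s *\<^sub>R F s \<partial>M) = cmint \<mu> (A t) f" for t
  proof -
    have "A t \<in> sets borel"
    proof -
      have "(\<lambda>s. (s, t)) -` {p. fst p \<in> A (snd p)} \<inter> space borel \<in> sets borel"
        by (rule measurable_sets[OF _ A(1)]) simp
      then show ?thesis by simp
    qed
    then have "(\<lambda>s. indicator (A t) s *\<^sub>R F s) \<in> borel_measurable (var \<mu>)"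
      by (simp add: measurable_var_iff)
    then have "(\<integral>s. indicator (A t) s *\<^sub>R F s \<partial>M)
      = (\<integral>s. indicator K s *\<^sub>R (indicator (A t) s *\<^sub>R F s) \<partial>var \<mu>)"
      unfolding M_def by (intro integral_density) auto
    also have "\<dots> = cmint \<mu> (A t) f"
      unfolding cmint_def set_lebesgue_integral_def F_def
      by (intro Bochner_Integration.integral_cong) (use A(2)[of t] in \<open>auto simp: indicator_def\<close>)
    finally show ?thesis .
  qed
  ultimately have "(\<lambda>t. cmint \<mu> (A t) f) \<in> borel_measurable borel" by simp
  then have "set_borel_measurable borel S (\<lambda>t. cmint \<mu> (A t) f)"
    unfolding set_borel_measurable_def using S by measurable
  moreover have "norm (cmint \<mu> (A t) f) \<le> (\<integral>t. norm (indicator K t *\<^sub>R f t) \<partial>var \<mu>)" for t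
  proof (rule norm_cmint_le_integral[OF f A(2)])
    have "(\<lambda>s. (s, t)) -` {p. fst p \<in> A (snd p)} \<inter> space borel \<in> sets borel"
      by (rule measurable_sets[OF _ A(1)]) simp
    then show "A t \<in> sets borel" by simp
  qed
  then have "bounded ((\<lambda>t. cmint \<mu> (A t) f) ` S)" unfolding bounded_iff by blast
  ultimately show ?thesis unfolding bmeas_def by simp
qed

lemma cmint_cong_AE:
  assumes "set_integrable (var \<mu>) A f" "set_integrable (var \<mu>) A h"
    and "AE t in var \<mu>. t \<in> A \<longrightarrow> f t = h t"
  shows "cmint \<mu> A f = cmint \<mu> A h"
  unfolding cmint_def set_lebesgue_integral_def
proof (rule integral_cong_AE)
  show "(\<lambda>t. indicator A t *\<^sub>R (f t * dens \<mu> t)) \<in> borel_measurable (var \<mu>)"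
    "(\<lambda>t. indicator A t *\<^sub>R (h t * dens \<mu> t)) \<in> borel_measurable (var \<mu>)"
    using set_integrable_dens[OF assms(1)] set_integrable_dens[OF assms(2)]
    unfolding set_integrable_def by (blast intro: borel_measurable_integrable)+
  show "AE t in var \<mu>. indicator A t *\<^sub>R (f t * dens \<mu> t) = indicator A t *\<^sub>R (h t * dens \<mu> t)"
    using assms(3) by eventually_elim (auto simp: indicator_def)
qed

text \<open>Chasles' relation for every position of \<open>c\<close>: differences of signed
  integrals become integrals over \<open>{x..<y}\<close>, and the base point disappears.\<close>

lemma cint_split:
  assumes f: "L1loc a b \<mu> f" and x: "c \<in> ival a b" "x \<in> ival a b" "y \<in> ival a b" "x \<le> y"
  shows "cint \<mu> c y f - cint \<mu> c x f = cmint \<mu> {x..<y} f"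
proof -
  have int: "set_integrable (var \<mu>) {s..<t} f" if "s \<in> ival a b" "t \<in> ival a b" for s t
  proof (rule set_integrable_subset[of _ "{s..t}"])
    show "set_integrable (var \<mu>) {s..t} f"
      using f ival_Icc_subset[OF that] unfolding L1loc_def by blast
  qed auto
  have un: "cmint \<mu> {r..<t} f = cmint \<mu> {r..<s} f + cmint \<mu> {s..<t} f"
    if "r \<in> ival a b" "s \<in> ival a b" "t \<in> ival a b" "r \<le> s" "s \<le> t" for r s t
  proof -
    have "{r..<t} = {r..<s} \<union> {s..<t}" using that by auto
    then show ?thesis using cmint_Un[of "{r..<s}" "{s..<t}" f] int that by auto
  qed
  consider "c \<le> x" | "x < c" "c \<le> y" | "x < c" "y < c" by linarith
  then show ?thesis
  proof cases
    case 1
    then show ?thesis using un[of c x y] x by (simp add: cint_eq_cmint)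
  next
    case 2
    then show ?thesis using un[of x c y] x by (simp add: cint_eq_cmint)
  next
    case 3
    then show ?thesis using un[of x y c] x by (simp add: cint_eq_cmint)
  qed
qed

text \<open>Continuity from above: the punctured neighbourhoods decrease to the empty set. Removing
  \<open>p\<close> is essential, since \<open>p\<close> may carry a point mass.\<close>

lemma eventually_measure_punctured:
  assumes p: "p \<in> ival a b" and e: "e > 0"
  shows "\<forall>\<^sub>F d in at_right 0. measure (var \<mu>) ({p - d..p + d} - {p}) < e"
proof -
  obtain d0 where d0: "d0 > 0" "{p - d0..p + d0} \<subseteq> ival a b" using ival_ball[OF p] by blast
  then have pd: "p - d0 \<in> ival a b" "p + d0 \<in> ival a b" by auto
  \<comment> \<open>The radii start at \<open>d0\<close>, so that all these sets lie in a compact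
    interval of finite variation.\<close>
  define A where "A n = {p - d0 / Suc n..p + d0 / Suc n} - {p}" for n
  have sub: "d0 / Suc n \<le> d0" for n using d0(1) by (simp add: field_simps)
  have dec: "decseq A"
  proof (rule decseq_SucI)
    fix n
    have "d0 / Suc (Suc n) \<le> d0 / Suc n" using d0 by (intro divide_left_mono) auto
    then show "A (Suc n) \<subseteq> A n" unfolding A_def by auto
  qed
  have "(\<lambda>n. measure (var \<mu>) (A n)) \<longlonglongrightarrow> measure (var \<mu>) (\<Inter>n. A n)"
  proof (rule Lim_measure_decseq[OF _ dec])
    show "range A \<subseteq> sets (var \<mu>)" by (auto simp: A_def)
    fix n
    have "A n \<subseteq> {p - d0..p + d0}" using sub[of n] by (auto simp: A_def)
    then show "emeasure (var \<mu>) (A n) \<noteq> \<infinity>" using emeasure_finite[OF pd] by (simp add: less_top)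
  qed
  moreover have "(\<Inter>n. A n) = {}"
  proof (rule ccontr)
    assume "(\<Inter>n. A n) \<noteq> {}"
    then obtain t where t: "\<And>n. t \<in> A n" by blast
    then have "t \<noteq> p" by (auto simp: A_def)
    then obtain n where "d0 / \<bar>t - p\<bar> < Suc n" using reals_Archimedean2
      by (metis less_trans lessI of_nat_less_iff)
    then have "d0 / Suc n < \<bar>t - p\<bar>" using \<open>t \<noteq> p\<close> by (simp add: field_simps)
    then show False using t[of n] by (auto simp: A_def)
  qed
  ultimately have "\<forall>\<^sub>F n in sequentially. measure (var \<mu>) (A n) < e"
    using e by (intro order_tendstoD) auto
  then obtain n where n: "measure (var \<mu>) (A n) < e" unfolding eventually_sequentially by blast
  have "measure (var \<mu>) ({p - d..p + d} - {p}) < e" if d: "0 < d" "d < d0 / Suc n" for d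
  proof -
    have "A n \<subseteq> {p - d0..p + d0}" using sub[of n] by (auto simp: A_def)
    then have fin: "emeasure (var \<mu>) (A n) < \<infinity>" using emeasure_finite[OF pd] by simp
    have "measure (var \<mu>) ({p - d..p + d} - {p}) \<le> measure (var \<mu>) (A n)"
      using d fin by (intro measure_mono_fmeasurable) (auto simp: A_def fmeasurable_def)
    then show ?thesis using n by simp
  qed
  moreover have "d0 / Suc n > 0" using d0 by simp
  ultimately show ?thesis unfolding eventually_at_right_field by (intro exI[of _ "d0 / Suc n"]) auto
qed

lemma measure_subset_le:
  assumes "\<alpha> \<in> ival a b" "\<beta> \<in> ival a b" "A \<subseteq> B" "B \<subseteq> {\<alpha>..\<beta>}" "A \<in> sets borel" "B \<in> sets borel"
  shows "measure (var \<mu>) A \<le> measure (var \<mu>) B"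
  using assms emeasure_finite[OF assms(1,2,4)]
  by (intro measure_mono_fmeasurable) (auto simp: fmeasurable_def)

text \<open>On the set where the imaginary part of the density has a fixed sign its integral
  vanishes, because the measure of that set is real. Hence that set is null, for either
  sign.\<close>

lemma real_cmeasure_dens_Reals:
  assumes re: "real_cmeasure a b \<mu>" and x: "x \<in> ival a b" "y \<in> ival a b"
  shows "AE t in var \<mu>. t \<in> {x..y} \<longrightarrow> dens \<mu> t \<in> \<real>"
proof -
  have int1: "set_integrable (var \<mu>) A (\<lambda>t. 1)" if "A \<in> sets borel" "A \<subseteq> {x..y}" for A
    using emeasure_finite[OF x that(2)] that(1) by (simp add: set_integrable_def)
  \<comment> \<open>The sign \<open>e\<close> treats the positive and the negative imaginary part in
    one argument.\<close>
  have key: "AE t in var \<mu>. t \<in> {x..y} \<longrightarrow> e * Im (dens \<mu> t) \<le> 0" if e: "e = 1 \<or> e = -1" for e :: real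
  proof -
    define A where "A = {t \<in> {x..y}. e * Im (dens \<mu> t) > 0}"
    have A [measurable]: "A \<in> sets borel" unfolding A_def by measurable
    have sub: "A \<subseteq> {x..y}" by (auto simp: A_def)
    have int: "integrable (var \<mu>) (\<lambda>t. indicator A t *\<^sub>R dens \<mu> t)"
      using set_integrable_dens[OF int1[OF A sub]] by (simp add: set_integrable_def)
    have "cmeasure \<mu> A \<in> \<real>"
      using re A sub ival_Icc_subset[OF x] unfolding real_cmeasure_def by blast
    then have "(\<integral>t. Im (indicator A t *\<^sub>R dens \<mu> t) \<partial>var \<mu>) = 0"
      unfolding integral_Im[OF int]
      by (simp add: cmeasure_def set_lebesgue_integral_def complex_is_Real_iff)
    then have "(\<integral>t. e * Im (indicator A t *\<^sub>R dens \<mu> t) \<partial>var \<mu>) = 0" by simp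
    moreover have "integrable (var \<mu>) (\<lambda>t. e * Im (indicator A t *\<^sub>R dens \<mu> t))"
      using int by (intro integrable_mult_right integrable_Im)
    moreover have "AE t in var \<mu>. 0 \<le> e * Im (indicator A t *\<^sub>R dens \<mu> t)"
      by (rule AE_I2) (auto simp: A_def indicator_def)
    ultimately have "AE t in var \<mu>. e * Im (indicator A t *\<^sub>R dens \<mu> t) = 0"
      using integral_nonneg_eq_0_iff_AE by blast
    then show ?thesis
      by eventually_elim (auto simp: A_def indicator_def split: if_splits)
  qed
  show ?thesis
    using key[of 1, simplified] key[of "-1", simplified]
    by eventually_elim (auto simp: complex_is_Real_iff)
qed

text \<open>The density is real almost everywhere on \<open>{x..y}\<close>, so conjugating the
  integral only conjugates \<open>f\<close>.\<close>

lemma cmint_cnj: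
  assumes re: "real_cmeasure a b \<mu>" and x: "x \<in> ival a b" "y \<in> ival a b"
    and f: "set_integrable (var \<mu>) {x..<y} f"
  shows "cmint \<mu> {x..<y} (\<lambda>t. cnj (f t)) = cnj (cmint \<mu> {x..<y} f)"
proof -
  have f': "integrable (var \<mu>) (\<lambda>t. indicator {x..<y} t *\<^sub>R (f t * dens \<mu> t))"
    using set_integrable_dens[OF f] by (simp add: set_integrable_def)
  have m: "(\<lambda>t. indicator {x..<y} t *\<^sub>R f t) \<in> borel_measurable borel"
    using f borel_measurable_integrable unfolding set_integrable_def measurable_var_iff[symmetric] by auto
  have "cnj (cmint \<mu> {x..<y} f) = (\<integral>t. cnj (indicator {x..<y} t *\<^sub>R (f t * dens \<mu> t)) \<partial>var \<mu>)"
    unfolding cmint_def set_lebesgue_integral_def by (rule Bochner_Integration.integral_cnj[symmetric])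
  also have "\<dots> = cmint \<mu> {x..<y} (\<lambda>t. cnj (f t))"
    unfolding cmint_def set_lebesgue_integral_def
  proof (rule integral_cong_AE)
    show "(\<lambda>t. cnj (indicator {x..<y} t *\<^sub>R (f t * dens \<mu> t))) \<in> borel_measurable (var \<mu>)"
      using f' by (intro borel_measurable_integrable complex_integrable_cnj[THEN iffD2])
    have "(\<lambda>t. cnj (indicator {x..<y} t *\<^sub>R f t) * dens \<mu> t) \<in> borel_measurable borel"
      by (intro borel_measurable_times dens_measurable
          measurable_compose[OF m] borel_measurable_continuous_onI continuous_intros)
    then show "(\<lambda>t. indicator {x..<y} t *\<^sub>R (cnj (f t) * dens \<mu> t)) \<in> borel_measurable (var \<mu>)"
      unfolding measurable_var_iff complex_cnj_scaleR by (simp only: mult_scaleR_left)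
    show "AE t in var \<mu>. cnj (indicator {x..<y} t *\<^sub>R (f t * dens \<mu> t))
        = indicator {x..<y} t *\<^sub>R (cnj (f t) * dens \<mu> t)"
      using real_cmeasure_dens_Reals[OF re x]
      by eventually_elim (auto simp: indicator_def Reals_cnj_iff)
  qed
  finally show ?thesis by simp
qed

end

text \<open>These are the families of integration sets for \<open>cint\<close>, for the forward and
  for the backward Volterra equation. The intersection with a fixed interval keeps every section
  inside one set even for parameters outside that interval, as \<open>bmeas_cmint\<close>
  demands.\<close>

lemma sets_less_section:
  "{p :: real \<times> real. fst p \<in> {\<alpha>..<snd p} \<inter> {\<gamma>..\<beta>}} \<in> sets (borel \<Otimes>\<^sub>M borel)"
  "{p :: real \<times> real. fst p \<in> {\<alpha><..<snd p} \<inter> {\<gamma><..<\<beta>}} \<in> sets (borel \<Otimes>\<^sub>M borel)"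
  "{p :: real \<times> real. fst p \<in> {snd p..<\<beta>} \<inter> {\<gamma><..<\<beta>}} \<in> sets (borel \<Otimes>\<^sub>M borel)"
proof -
  have [simp]: "space (borel \<Otimes>\<^sub>M borel :: (real \<times> real) measure) = UNIV"
    by (simp add: space_pair_measure)
  have "Measurable.pred (borel \<Otimes>\<^sub>M borel)
      (\<lambda>p :: real \<times> real. \<alpha> \<le> fst p \<and> fst p < snd p \<and> \<gamma> \<le> fst p \<and> fst p \<le> \<beta>)"
    "Measurable.pred (borel \<Otimes>\<^sub>M borel)
      (\<lambda>p :: real \<times> real. \<alpha> < fst p \<and> fst p < snd p \<and> \<gamma> < fst p \<and> fst p < \<beta>)"
    "Measurable.pred (borel \<Otimes>\<^sub>M borel)
      (\<lambda>p :: real \<times> real. snd p \<le> fst p \<and> fst p < \<beta> \<and> \<gamma> < fst p \<and> fst p < \<beta>)"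
    by measurable
  from this[THEN predE] show
    "{p :: real \<times> real. fst p \<in> {\<alpha>..<snd p} \<inter> {\<gamma>..\<beta>}} \<in> sets (borel \<Otimes>\<^sub>M borel)"
    "{p :: real \<times> real. fst p \<in> {\<alpha><..<snd p} \<inter> {\<gamma><..<\<beta>}} \<in> sets (borel \<Otimes>\<^sub>M borel)"
    "{p :: real \<times> real. fst p \<in> {snd p..<\<beta>} \<inter> {\<gamma><..<\<beta>}} \<in> sets (borel \<Otimes>\<^sub>M borel)"
    by (simp_all add: conj_ac)
qed

context loc_finite
begin

text \<open>Splitting at \<alpha> leaves a constant plus an integral over
  \<open>{\<alpha>..<t}\<close>, whatever the position of \<open>c\<close>.\<close>

lemma bmeas_cint:
  assumes f: "L1loc a b \<mu> f" and x: "c \<in> ival a b" "\<alpha> \<in> ival a b" "\<beta> \<in> ival a b"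
  shows "bmeas {\<alpha>..\<beta>} (\<lambda>x. cint \<mu> c x f)"
proof -
  have sub: "{\<alpha>..\<beta>} \<subseteq> ival a b" using ival_Icc_subset x by blast
  have "bmeas {\<alpha>..\<beta>} (\<lambda>t. cmint \<mu> ({\<alpha>..<t} \<inter> {\<alpha>..\<beta>}) f)"
  proof (rule bmeas_cmint[of "{\<alpha>..\<beta>}"])
    show "set_integrable (var \<mu>) {\<alpha>..\<beta>} f" using f sub unfolding L1loc_def by blast
    show "emeasure (var \<mu>) {\<alpha>..\<beta>} < \<infinity>" using emeasure_finite x by blast
  qed (use sets_less_section(1) in auto)
  then have "bmeas {\<alpha>..\<beta>} (\<lambda>t. cint \<mu> c \<alpha> f + cmint \<mu> ({\<alpha>..<t} \<inter> {\<alpha>..\<beta>}) f)"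
    by (intro bmeas_add bmeas_const) auto
  then show ?thesis
  proof (rule bmeas_cong)
    fix t assume t: "t \<in> {\<alpha>..\<beta>}"
    then have "{\<alpha>..<t} \<inter> {\<alpha>..\<beta>} = {\<alpha>..<t}" by auto
    then show "cint \<mu> c \<alpha> f + cmint \<mu> ({\<alpha>..<t} \<inter> {\<alpha>..\<beta>}) f = cint \<mu> c t f"
      using cint_split[OF f x(1,2), of t] t sub by (auto simp: algebra_simps)
  qed
qed

lemma bmeas_L1loc:
  assumes c: "c \<in> ival a b"
    and f: "\<And>\<alpha> \<beta>. \<alpha> \<in> ival a b \<Longrightarrow> \<beta> \<in> ival a b \<Longrightarrow> bmeas {\<alpha>..\<beta>} f"
  shows "L1loc a b \<mu> f"
  unfolding L1loc_def
proof (intro allI impI)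
  fix K assume K: "compact K \<and> K \<subseteq> ival a b"
  obtain \<alpha> \<beta> where *: "\<alpha> \<in> ival a b" "\<beta> \<in> ival a b" "K \<subseteq> {\<alpha>..\<beta>}"
    by (rule ival_compact_Icc[OF conjunct1[OF K] conjunct2[OF K] c])
  then have "set_integrable (var \<mu>) {\<alpha>..\<beta>} f"
    by (intro bmeas_set_integrable[OF f, of \<alpha> \<beta> \<alpha> \<beta>]) auto
  then show "set_integrable (var \<mu>) K f"
    by (rule set_integrable_subset) (use * K in \<open>simp_all add: borel_compact\<close>)
qed

lemma L1loc_set_integrable:
  assumes "L1loc a b \<mu> f" "\<alpha> \<in> ival a b" "\<beta> \<in> ival a b" "A \<subseteq> {\<alpha>..\<beta>}" "A \<in> sets borel"
  shows "set_integrable (var \<mu>) A f"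
proof (rule set_integrable_subset[of _ "{\<alpha>..\<beta>}"])
  show "set_integrable (var \<mu>) {\<alpha>..\<beta>} f"
    using assms(1) ival_Icc_subset[OF assms(2,3)] unfolding L1loc_def by blast
qed (use assms in auto)

end

section \<open>The first order system\<close>

definition bmeas_pair :: "real set \<Rightarrow> (real \<Rightarrow> complex \<times> complex) \<Rightarrow> bool" where
  "bmeas_pair S f \<longleftrightarrow> bmeas S (\<lambda>t. fst (f t)) \<and> bmeas S (\<lambda>t. snd (f t))"

lemma bmeas_pair_subset: "bmeas_pair S f \<Longrightarrow> T \<subseteq> S \<Longrightarrow> T \<in> sets borel \<Longrightarrow> bmeas_pair T f"
  unfolding bmeas_pair_def using bmeas_subset by blast

lemma bmeas_pair_cong: "bmeas_pair S f \<Longrightarrow> (\<And>t. t \<in> S \<Longrightarrow> f t = h t) \<Longrightarrow> bmeas_pair S h"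
  unfolding bmeas_pair_def by (auto intro: bmeas_cong)

lemma bmeas_pair_const: "S \<in> sets borel \<Longrightarrow> bmeas_pair S (\<lambda>t. d)"
  unfolding bmeas_pair_def by (simp add: bmeas_const)

lemma bmeas_pair_Un:
  "bmeas_pair S f \<Longrightarrow> bmeas_pair T f \<Longrightarrow> S \<in> sets borel \<Longrightarrow> T \<in> sets borel \<Longrightarrow> bmeas_pair (S \<union> T) f"
  unfolding bmeas_pair_def by (simp add: bmeas_Un)

lemma bmeas_pair_bounded:
  assumes "bmeas_pair S f"
  shows "bounded (f ` S)"
proof -
  have "bounded ((\<lambda>t. fst (f t)) ` S \<times> (\<lambda>t. snd (f t)) ` S)"
    using assms unfolding bmeas_pair_def bmeas_def by (intro bounded_Times) auto
  then show ?thesis by (rule bounded_subset) (clarsimp simp: image_iff, metis fst_conv snd_conv)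
qed

lemma bmeas_pair_uniform_limit:
  assumes fs: "\<And>n. bmeas_pair S (fs n)" and ul: "uniform_limit S fs f sequentially"
  shows "bmeas_pair S f"
proof -
  have *: "uniform_limit S (\<lambda>n t. fst (fs n t)) (\<lambda>t. fst (f t)) sequentially"
    "uniform_limit S (\<lambda>n t. snd (fs n t)) (\<lambda>t. snd (f t)) sequentially"
    using bounded_linear.uniform_limit[OF bounded_linear_fst ul]
      bounded_linear.uniform_limit[OF bounded_linear_snd ul] by simp_all
  moreover have "bmeas S (\<lambda>t. fst (fs n t))" "bmeas S (\<lambda>t. snd (fs n t))" for n
    using fs[of n] by (auto simp: bmeas_pair_def)
  ultimately show ?thesis
    unfolding bmeas_pair_def using bmeas_uniform_limit[OF _ *(1)] bmeas_uniform_limit[OF _ *(2)] by simp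
qed

section \<open>Increments of the system and the Volterra equation\<close>

locale sturm_liouville =
  r: loc_finite a b \<rho> + s: loc_finite a b \<sigma> + k: loc_finite a b \<kappa>
  for a b :: ereal and \<rho> \<sigma> \<kappa> :: cmeas +
  fixes g :: "real \<Rightarrow> complex" and z :: complex
  assumes g: "L1loc a b \<rho> g"
begin

text \<open>The pair \<open>f\<close> stands for \<open>(u, w)\<close>, with \<open>w\<close> the quasi-derivative of \<open>u\<close>.\<close>

definition incr :: "real set \<Rightarrow> (real \<Rightarrow> complex \<times> complex) \<Rightarrow> complex \<times> complex" where
  "incr A f = (cmint \<sigma> A (\<lambda>t. snd (f t)),
     cmint \<kappa> A (\<lambda>t. fst (f t)) - cmint \<rho> A (\<lambda>t. z * fst (f t) + g t))"

text \<open>The solution is left-continuous, so \<open>jump x (f x)\<close> is its right limit at \<open>x\<close>.\<close>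

definition jump :: "real \<Rightarrow> complex \<times> complex \<Rightarrow> complex \<times> complex" where
  "jump x v = v + (snd v * cmeasure \<sigma> {x},
     fst v * cmeasure \<kappa> {x} - (z * fst v + g x) * cmeasure \<rho> {x})"

text \<open>This is the Lipschitz constant of \<open>incr A\<close> in the supremum norm, see
  \<open>incr_diff_le\<close>. The inhomogeneity \<open>g\<close> cancels in differences and leaves
  no trace.\<close>

definition total_var :: "real set \<Rightarrow> real" where
  "total_var A = measure (var \<sigma>) A + measure (var \<kappa>) A + norm z * measure (var \<rho>) A"

text \<open>The increment equation is imposed on all subintervals, which makes restriction and
  gluing direct. For \<alpha> > \<beta> the condition is vacuous.\<close>

definition sol :: "real \<Rightarrow> real \<Rightarrow> (real \<Rightarrow> complex \<times> complex) \<Rightarrow> bool" where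
  "sol \<alpha> \<beta> f \<longleftrightarrow> bmeas_pair {\<alpha>..\<beta>} f \<and>
     (\<forall>x y. \<alpha> \<le> x \<longrightarrow> x \<le> y \<longrightarrow> y \<le> \<beta> \<longrightarrow> f y = f x + incr {x..<y} f)"

lemma incr_empty [simp]: "incr {} f = 0"
  by (simp add: incr_def zero_prod_def)

lemma incr_cong: "(\<And>t. t \<in> A \<Longrightarrow> f t = h t) \<Longrightarrow> incr A f = incr A h"
  unfolding incr_def by (auto intro!: cmint_cong arg_cong2[where f = "(-)"])

lemma jump_eq_incr: "jump x (f x) = f x + incr {x} f"
  by (simp add: jump_def incr_def cmint_singleton)

lemma bmeas_pair_integrable:
  assumes "bmeas_pair A f" "A \<subseteq> {\<alpha>..\<beta>}" "\<alpha> \<in> ival a b" "\<beta> \<in> ival a b" "A \<in> sets borel"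
  shows "set_integrable (var \<sigma>) A (\<lambda>t. snd (f t))"
    "set_integrable (var \<kappa>) A (\<lambda>t. fst (f t))"
    "set_integrable (var \<rho>) A (\<lambda>t. fst (f t))"
    "set_integrable (var \<rho>) A (\<lambda>t. z * fst (f t) + g t)"
proof -
  have f: "bmeas A (\<lambda>t. fst (f t))" "bmeas A (\<lambda>t. snd (f t))"
    using assms(1) by (auto simp: bmeas_pair_def)
  show "set_integrable (var \<sigma>) A (\<lambda>t. snd (f t))"
    "set_integrable (var \<kappa>) A (\<lambda>t. fst (f t))"
    "set_integrable (var \<rho>) A (\<lambda>t. fst (f t))"
    using s.bmeas_set_integrable[OF f(2) assms(2-5)] k.bmeas_set_integrable[OF f(1) assms(2-5)]
      r.bmeas_set_integrable[OF f(1) assms(2-5)] by auto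
  then show "set_integrable (var \<rho>) A (\<lambda>t. z * fst (f t) + g t)"
    using r.L1loc_set_integrable[OF g assms(3,4,2,5)] by (intro set_integral_add set_integrable_mult_right)
qed

lemma incr_Un:
  assumes f: "bmeas_pair (A \<union> B) f" and AB: "A \<inter> B = {}" "A \<union> B \<subseteq> {\<alpha>..\<beta>}"
    and ival: "\<alpha> \<in> ival a b" "\<beta> \<in> ival a b" and sets: "A \<in> sets borel" "B \<in> sets borel"
  shows "incr (A \<union> B) f = incr A f + incr B f"
proof -
  have A: "bmeas_pair A f" "A \<subseteq> {\<alpha>..\<beta>}" and B: "bmeas_pair B f" "B \<subseteq> {\<alpha>..\<beta>}"
    using bmeas_pair_subset[OF f] AB sets by auto
  note iA = bmeas_pair_integrable[OF A ival sets(1)] and iB = bmeas_pair_integrable[OF B ival sets(2)]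
  show ?thesis
    unfolding incr_def s.cmint_Un[OF AB(1) iA(1) iB(1)] k.cmint_Un[OF AB(1) iA(2) iB(2)]
      r.cmint_Un[OF AB(1) iA(4) iB(4)] by simp
qed

lemma incr_diff_le:
  assumes f: "bmeas_pair A f" and h: "bmeas_pair A h" and A: "A \<subseteq> {\<alpha>..\<beta>}" 
    and ival: "\<alpha> \<in> ival a b" "\<beta> \<in> ival a b" and sets: "A \<in> sets borel"
    and le: "\<And>t. t \<in> A \<Longrightarrow> norm (f t - h t) \<le> C"
  shows "norm (incr A f - incr A h) \<le> C * total_var A"
proof -
  note i = bmeas_pair_integrable[OF f A ival sets] and j = bmeas_pair_integrable[OF h A ival sets]
  have le1: "norm (fst (f t) - fst (h t)) \<le> C" "norm (snd (f t) - snd (h t)) \<le> C" if "t \<in> A" for t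
    using le[OF that] norm_fst_le[of "fst (f t - h t)" "snd (f t - h t)"]
      norm_snd_le[of "snd (f t - h t)" "fst (f t - h t)"] unfolding prod.collapse by simp_all
  have 1: "norm (cmint \<sigma> A (\<lambda>t. snd (f t)) - cmint \<sigma> A (\<lambda>t. snd (h t))) \<le> C * measure (var \<sigma>) A"
    unfolding s.cmint_diff[OF i(1) j(1), symmetric]
    using le1(2) sets s.emeasure_finite[OF ival A] i(1) j(1)
    by (intro s.norm_cmint_le set_integral_diff) auto
  have 2: "norm (cmint \<kappa> A (\<lambda>t. fst (f t)) - cmint \<kappa> A (\<lambda>t. fst (h t))) \<le> C * measure (var \<kappa>) A"
    unfolding k.cmint_diff[OF i(2) j(2), symmetric]
    using le1(1) sets k.emeasure_finite[OF ival A] i(2) j(2)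
    by (intro k.norm_cmint_le set_integral_diff) auto
  have 3: "norm (cmint \<rho> A (\<lambda>t. z * fst (f t) + g t) - cmint \<rho> A (\<lambda>t. z * fst (h t) + g t))
      \<le> (norm z * C) * measure (var \<rho>) A"
    unfolding r.cmint_diff[OF i(4) j(4), symmetric]
  proof (intro r.norm_cmint_le set_integral_diff i j sets r.emeasure_finite[OF ival A])
    fix t assume "t \<in> A"
    have "z * fst (f t) + g t - (z * fst (h t) + g t) = z * (fst (f t) - fst (h t))"
      by (simp add: algebra_simps)
    then show "norm (z * fst (f t) + g t - (z * fst (h t) + g t)) \<le> norm z * C"
      using le1(1)[OF \<open>t \<in> A\<close>] by (simp add: norm_mult mult_left_mono)
  qed
  let ?d1 = "cmint \<sigma> A (\<lambda>t. snd (f t)) - cmint \<sigma> A (\<lambda>t. snd (h t))"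
  let ?d2 = "cmint \<kappa> A (\<lambda>t. fst (f t)) - cmint \<kappa> A (\<lambda>t. fst (h t))"
  let ?d3 = "cmint \<rho> A (\<lambda>t. z * fst (f t) + g t) - cmint \<rho> A (\<lambda>t. z * fst (h t) + g t)"
  have "norm (incr A f - incr A h) = norm (?d1, ?d2 - ?d3)"
    by (simp add: incr_def algebra_simps)
  also have "\<dots> \<le> norm ?d1 + (norm ?d2 + norm ?d3)"
    using norm_Pair_le[of ?d1 "?d2 - ?d3"] norm_triangle_ineq4[of ?d2 ?d3] by simp
  also have "\<dots> \<le> C * total_var A"
    using 1 2 3 by (simp add: total_var_def algebra_simps)
  finally show ?thesis .
qed

lemma total_var_mono:
  assumes "\<alpha> \<in> ival a b" "\<beta> \<in> ival a b" "A \<subseteq> B" "B \<subseteq> {\<alpha>..\<beta>}" "A \<in> sets borel" "B \<in> sets borel"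
  shows "total_var A \<le> total_var B"
  unfolding total_var_def
  using s.measure_subset_le[OF assms] k.measure_subset_le[OF assms] r.measure_subset_le[OF assms]
  by (intro add_mono mult_left_mono) auto

lemma bmeas_pair_incr:
  assumes f: "bmeas_pair K f" and K: "K \<subseteq> {\<alpha>..\<beta>}" "\<alpha> \<in> ival a b" "\<beta> \<in> ival a b" "K \<in> sets borel"
    and A: "{p. fst p \<in> A (snd p)} \<in> sets (borel \<Otimes>\<^sub>M borel)" "\<And>t. A t \<subseteq> K"
    and S: "S \<in> sets borel"
  shows "bmeas_pair S (\<lambda>t. incr (A t) f)"
proof -
  note i = bmeas_pair_integrable[OF f K]
  have "bmeas S (\<lambda>t. cmint \<sigma> (A t) (\<lambda>t. snd (f t)))"
    using s.bmeas_cmint[OF i(1) K(4) s.emeasure_finite[OF K(2,3,1)] A S] .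
  moreover have "bmeas S (\<lambda>t. cmint \<kappa> (A t) (\<lambda>t. fst (f t)))"
    using k.bmeas_cmint[OF i(2) K(4) k.emeasure_finite[OF K(2,3,1)] A S] .
  moreover have "bmeas S (\<lambda>t. cmint \<rho> (A t) (\<lambda>t. z * fst (f t) + g t))"
    using r.bmeas_cmint[OF i(4) K(4) r.emeasure_finite[OF K(2,3,1)] A S] .
  ultimately show ?thesis
    unfolding bmeas_pair_def incr_def by (simp add: bmeas_diff)
qed

lemma bmeas_pair_affine:
  assumes "bmeas_pair S f" "S \<in> sets borel"
  shows "bmeas_pair S (\<lambda>t. e + \<epsilon> *\<^sub>R f t)"
  using assms unfolding bmeas_pair_def
  by (auto simp: scaleR_conv_of_real intro!: bmeas_add bmeas_const bmeas_cmult)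

text \<open>The initial value is prescribed either as right limit at \<open>\<alpha>\<close> (with \<open>A t = {\<alpha><..<t}\<close> and \<open>\<epsilon> = 1\<close>) or at \<open>\<beta>\<close>
  (with \<open>A t = {t..<\<beta>}\<close> and \<open>\<epsilon> = -1\<close>). In both cases only the open interval has to have small variation.\<close>

lemma volterra_contraction:
  assumes ab: "\<alpha> \<in> ival a b" "\<beta> \<in> ival a b" and small: "total_var {\<alpha><..<\<beta>} \<le> 1/2"
    and A: "{p. fst p \<in> A (snd p)} \<in> sets (borel \<Otimes>\<^sub>M borel)" "\<And>t. A t \<subseteq> {\<alpha><..<\<beta>}"
    and \<epsilon>: "\<bar>\<epsilon>\<bar> = 1"
    and f: "bmeas_pair {\<alpha><..\<beta>} f" and h: "bmeas_pair {\<alpha><..\<beta>} h"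
    and le: "\<And>t. t \<in> {\<alpha><..\<beta>} \<Longrightarrow> norm (f t - h t) \<le> C" and x: "x \<in> {\<alpha><..\<beta>}"
  shows "norm ((e + \<epsilon> *\<^sub>R incr (A x) f) - (e + \<epsilon> *\<^sub>R incr (A x) h)) \<le> C / 2"
proof -
  have sets: "A x \<in> sets borel"
  proof -
    have "(\<lambda>s. (s, x)) -` {p. fst p \<in> A (snd p)} \<inter> space borel \<in> sets borel"
      by (rule measurable_sets[OF _ A(1)]) simp
    then show ?thesis by simp
  qed
  have sub: "A x \<subseteq> {\<alpha><..\<beta>}" "A x \<subseteq> {\<alpha>..\<beta>}" using A(2)[of x] by force+
  have "0 \<le> C" using le[OF x] norm_ge_zero order_trans by blast
  have "(e + \<epsilon> *\<^sub>R incr (A x) f) - (e + \<epsilon> *\<^sub>R incr (A x) h) = \<epsilon> *\<^sub>R (incr (A x) f - incr (A x) h)"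
    by (simp add: scaleR_diff_right)
  then have "norm ((e + \<epsilon> *\<^sub>R incr (A x) f) - (e + \<epsilon> *\<^sub>R incr (A x) h))
      = norm (incr (A x) f - incr (A x) h)" using \<epsilon> by simp
  also have "\<dots> \<le> C * total_var (A x)"
    using bmeas_pair_subset[OF f sub(1) sets] bmeas_pair_subset[OF h sub(1) sets] sub(2) ab sets
    by (rule incr_diff_le) (use le sub(1) in blast)
  also have "\<dots> \<le> C * (1/2)"
    using total_var_mono[OF ab A(2)[of x] greaterThanLessThan_subseteq_atLeastAtMost_iff[THEN iffD2] sets]
      small \<open>0 \<le> C\<close> by (intro mult_left_mono) auto
  finally show ?thesis by simp
qed

text \<open>The point \<alpha> is left out of the domain: its value never enters an integral over
  \<open>A t\<close>, and a point mass there cannot spoil the contraction.\<close>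

lemma volterra_exists:
  assumes ab: "\<alpha> \<in> ival a b" "\<beta> \<in> ival a b" and small: "total_var {\<alpha><..<\<beta>} \<le> 1/2"
    and A: "{p. fst p \<in> A (snd p)} \<in> sets (borel \<Otimes>\<^sub>M borel)" "\<And>t. A t \<subseteq> {\<alpha><..<\<beta>}"
    and \<epsilon>: "\<bar>\<epsilon>\<bar> = 1"
  obtains (fixed_point) f where "bmeas_pair {\<alpha><..\<beta>} f" "\<And>t. t \<in> {\<alpha><..\<beta>} \<Longrightarrow> f t = e + \<epsilon> *\<^sub>R incr (A t) f"
proof (rule contraction_fixed_point[where G = "bmeas_pair {\<alpha><..\<beta>}" and S = "{\<alpha><..\<beta>}"
      and T = "\<lambda>f t. e + \<epsilon> *\<^sub>R incr (A t) f"])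
  show "bmeas_pair {\<alpha><..\<beta>} (\<lambda>t. 0)" by (rule bmeas_pair_const) simp
  show "bmeas_pair {\<alpha><..\<beta>} (\<lambda>t. e + \<epsilon> *\<^sub>R incr (A t) f)" if "bmeas_pair {\<alpha><..\<beta>} f" for f
  proof (rule bmeas_pair_affine[OF bmeas_pair_incr[of "{\<alpha><..\<beta>}" f \<alpha> \<beta>]])
    show "A t \<subseteq> {\<alpha><..\<beta>}" for t using A(2)[of t] by force
  qed (use that ab A(1) in auto)
  show "norm ((e + \<epsilon> *\<^sub>R incr (A x) f) - (e + \<epsilon> *\<^sub>R incr (A x) h)) \<le> C / 2"
    if "bmeas_pair {\<alpha><..\<beta>} f" "bmeas_pair {\<alpha><..\<beta>} h"
      "\<And>t. t \<in> {\<alpha><..\<beta>} \<Longrightarrow> norm (f t - h t) \<le> C" "x \<in> {\<alpha><..\<beta>}" for f h C x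
    by (rule volterra_contraction[OF ab small A \<epsilon> that])
  show thesis if "bmeas_pair {\<alpha><..\<beta>} f" "\<And>t. t \<in> {\<alpha><..\<beta>} \<Longrightarrow> e + \<epsilon> *\<^sub>R incr (A t) f = f t" for f
    using fixed_point[OF that(1) that(2)[symmetric]] .
  show "bmeas_pair {\<alpha><..\<beta>} f"
    if "\<And>n. bmeas_pair {\<alpha><..\<beta>} (fs n)" "uniform_limit {\<alpha><..\<beta>} fs f sequentially" for fs f
    using that by (rule bmeas_pair_uniform_limit)
qed (rule bmeas_pair_bounded)

lemma volterra_unique:
  assumes ab: "\<alpha> \<in> ival a b" "\<beta> \<in> ival a b" and small: "total_var {\<alpha><..<\<beta>} \<le> 1/2"
    and A: "{p. fst p \<in> A (snd p)} \<in> sets (borel \<Otimes>\<^sub>M borel)" "\<And>t. A t \<subseteq> {\<alpha><..<\<beta>}"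
    and \<epsilon>: "\<bar>\<epsilon>\<bar> = 1"
    and f: "bmeas_pair {\<alpha><..\<beta>} f" "\<And>t. t \<in> {\<alpha><..\<beta>} \<Longrightarrow> f t = e + \<epsilon> *\<^sub>R incr (A t) f"
    and h: "bmeas_pair {\<alpha><..\<beta>} h" "\<And>t. t \<in> {\<alpha><..\<beta>} \<Longrightarrow> h t = e + \<epsilon> *\<^sub>R incr (A t) h"
    and x: "x \<in> {\<alpha><..\<beta>}"
  shows "f x = h x"
proof (rule contraction_fixed_point_unique[where G = "bmeas_pair {\<alpha><..\<beta>}" and S = "{\<alpha><..\<beta>}"
      and T = "\<lambda>f t. e + \<epsilon> *\<^sub>R incr (A t) f"])
  show "x \<in> {\<alpha><..\<beta>}" by (rule x)
  show "bmeas_pair {\<alpha><..\<beta>} f" "bmeas_pair {\<alpha><..\<beta>} h" by (rule f h)+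
  show "e + \<epsilon> *\<^sub>R incr (A t) f = f t" "e + \<epsilon> *\<^sub>R incr (A t) h = h t" if "t \<in> {\<alpha><..\<beta>}" for t
    using f(2)[OF that] h(2)[OF that] by auto
  show "norm ((e + \<epsilon> *\<^sub>R incr (A x) f) - (e + \<epsilon> *\<^sub>R incr (A x) h)) \<le> C / 2"
    if "bmeas_pair {\<alpha><..\<beta>} f" "bmeas_pair {\<alpha><..\<beta>} h"
      "\<And>t. t \<in> {\<alpha><..\<beta>} \<Longrightarrow> norm (f t - h t) \<le> C" "x \<in> {\<alpha><..\<beta>}" for f h C x
    by (rule volterra_contraction[OF ab small A \<epsilon> that])
qed (rule bmeas_pair_bounded)

section \<open>Solutions on closed intervals and their local theory\<close>

lemma solD:
  assumes "sol \<alpha> \<beta> f"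
  shows "bmeas_pair {\<alpha>..\<beta>} f"
    "\<And>x y. \<alpha> \<le> x \<Longrightarrow> x \<le> y \<Longrightarrow> y \<le> \<beta> \<Longrightarrow> f y = f x + incr {x..<y} f"
  using assms unfolding sol_def by blast+

lemma sol_subinterval: "sol \<alpha> \<beta> f \<Longrightarrow> \<alpha> \<le> \<alpha>' \<Longrightarrow> \<beta>' \<le> \<beta> \<Longrightarrow> sol \<alpha>' \<beta>' f"
  unfolding sol_def
  by (meson atLeastatMost_subset_iff atLeastAtMost_borel bmeas_pair_subset order_trans)

lemma sol_cong:
  assumes "sol \<alpha> \<beta> f" "\<And>t. t \<in> {\<alpha>..\<beta>} \<Longrightarrow> f t = h t"
  shows "sol \<alpha> \<beta> h"
  unfolding sol_def
proof (intro conjI allI impI)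
  show "bmeas_pair {\<alpha>..\<beta>} h" using bmeas_pair_cong assms unfolding sol_def by blast
  fix x y assume xy: "\<alpha> \<le> x" "x \<le> y" "y \<le> \<beta>"
  have "incr {x..<y} f = incr {x..<y} h" using xy assms(2) by (intro incr_cong) auto
  then show "h y = h x + incr {x..<y} h"
    using solD(2)[OF assms(1) xy] assms(2)[of x] assms(2)[of y] xy by simp
qed

text \<open>Agreement at \<beta> suffices, because an increment across \<beta> splits into one
  increment on each side.\<close>

lemma sol_glue:
  assumes f: "sol \<alpha> \<beta> f" and h: "sol \<beta> \<gamma> h" and eq: "f \<beta> = h \<beta>"
    and ival: "\<alpha> \<in> ival a b" "\<gamma> \<in> ival a b" and le: "\<alpha> \<le> \<beta>" "\<beta> \<le> \<gamma>"
  shows "sol \<alpha> \<gamma> (\<lambda>t. if t \<le> \<beta> then f t else h t)"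
proof -
  define F where "F t = (if t \<le> \<beta> then f t else h t)" for t
  have "h t = F t" if "t \<in> {\<beta>..\<gamma>}" for t
    using eq that by (cases "t = \<beta>") (auto simp: F_def)
  then have F: "sol \<alpha> \<beta> F" "sol \<beta> \<gamma> F"
    using sol_cong[OF f, of F] sol_cong[OF h, of F] by (auto simp: F_def)
  have un: "{\<alpha>..\<gamma>} = {\<alpha>..\<beta>} \<union> {\<beta>..\<gamma>}" using le by auto
  have bmeas: "bmeas_pair {\<alpha>..\<gamma>} F"
    unfolding un using F by (intro bmeas_pair_Un solD) auto
  have "sol \<alpha> \<gamma> F"
    unfolding sol_def
  proof (intro conjI allI impI bmeas)
    fix x y assume xy: "\<alpha> \<le> x" "x \<le> y" "y \<le> \<gamma>"
    consider "y \<le> \<beta>" | "\<beta> \<le> x" | "x < \<beta>" "\<beta> < y" by linarith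
    then show "F y = F x + incr {x..<y} F"
    proof cases
      case 3
      have un': "{x..<y} = {x..<\<beta>} \<union> {\<beta>..<y}" using 3 by auto
      have "incr {x..<y} F = incr {x..<\<beta>} F + incr {\<beta>..<y} F"
        unfolding un' by (rule incr_Un[where \<alpha> = \<alpha> and \<beta> = \<gamma>, OF bmeas_pair_subset[OF bmeas]]) (use 3 xy ival in auto)
      then show ?thesis
        using solD(2)[OF F(1), of x \<beta>] solD(2)[OF F(2), of \<beta> y] 3 xy by simp
    qed (use xy solD(2)[OF F(1), of x y] solD(2)[OF F(2), of x y] in auto)
  qed
  then show ?thesis unfolding F_def[abs_def] .
qed

text \<open>Separating the point mass at \<alpha> turns the right limit into the initial value of an
  equation over the open interval, whose variation can be small.\<close>

lemma sol_jump:
  assumes f: "sol \<alpha> \<beta> f" and ival: "\<alpha> \<in> ival a b" "\<beta> \<in> ival a b" and t: "t \<in> {\<alpha><..\<beta>}"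
  shows "f t = jump \<alpha> (f \<alpha>) + incr {\<alpha><..<t} f"
proof -
  have un: "{\<alpha>..<t} = {\<alpha>} \<union> {\<alpha><..<t}" using t by auto
  have "incr {\<alpha>..<t} f = incr {\<alpha>} f + incr {\<alpha><..<t} f"
    unfolding un by (rule incr_Un[where \<alpha> = \<alpha> and \<beta> = \<beta>, OF bmeas_pair_subset[OF solD(1)[OF f]]]) (use t ival in auto)
  then show ?thesis using solD(2)[OF f, of \<alpha> t] t by (simp add: jump_eq_incr)
qed

text \<open>Only the right limits at \<alpha> have to agree, not the values. This weaker hypothesis
  is what the necessity argument exploits when the jump is not injective.\<close>

lemma local_unique_forward:
  assumes f: "sol \<alpha> \<beta> f" and h: "sol \<alpha> \<beta> h" and ival: "\<alpha> \<in> ival a b" "\<beta> \<in> ival a b"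
    and small: "total_var {\<alpha><..<\<beta>} \<le> 1/2" and eq: "jump \<alpha> (f \<alpha>) = jump \<alpha> (h \<alpha>)"
    and t: "t \<in> {\<alpha><..\<beta>}"
  shows "f t = h t"
proof (rule volterra_unique[OF ival small sets_less_section(2)])
  show "bmeas_pair {\<alpha><..\<beta>} f" "bmeas_pair {\<alpha><..\<beta>} h"
    by (rule bmeas_pair_subset[OF solD(1)[OF f]] bmeas_pair_subset[OF solD(1)[OF h]]; force)+
  show "f t = jump \<alpha> (f \<alpha>) + 1 *\<^sub>R incr ({\<alpha><..<t} \<inter> {\<alpha><..<\<beta>}) f"
    "h t = jump \<alpha> (f \<alpha>) + 1 *\<^sub>R incr ({\<alpha><..<t} \<inter> {\<alpha><..<\<beta>}) h" if t: "t \<in> {\<alpha><..\<beta>}" for t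
  proof -
    have "{\<alpha><..<t} \<inter> {\<alpha><..<\<beta>} = {\<alpha><..<t}" using t by auto
    then show "f t = jump \<alpha> (f \<alpha>) + 1 *\<^sub>R incr ({\<alpha><..<t} \<inter> {\<alpha><..<\<beta>}) f"
      "h t = jump \<alpha> (f \<alpha>) + 1 *\<^sub>R incr ({\<alpha><..<t} \<inter> {\<alpha><..<\<beta>}) h"
      using sol_jump[OF f ival t] sol_jump[OF h ival t] eq by simp_all
  qed
qed (use t in auto)

text \<open>The conclusion stops short of \<alpha>, so nothing has to be known about the jump
  there.\<close>

lemma local_unique_backward:
  assumes f: "sol \<alpha> \<beta> f" and h: "sol \<alpha> \<beta> h" and ival: "\<alpha> \<in> ival a b" "\<beta> \<in> ival a b"
    and small: "total_var {\<alpha><..<\<beta>} \<le> 1/2" and eq: "f \<beta> = h \<beta>" and t: "t \<in> {\<alpha><..\<beta>}"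
  shows "f t = h t"
proof (rule volterra_unique[OF ival small sets_less_section(3)])
  show "bmeas_pair {\<alpha><..\<beta>} f" "bmeas_pair {\<alpha><..\<beta>} h"
    by (rule bmeas_pair_subset[OF solD(1)[OF f]] bmeas_pair_subset[OF solD(1)[OF h]]; force)+
  show "f t = f \<beta> + (-1) *\<^sub>R incr ({t..<\<beta>} \<inter> {\<alpha><..<\<beta>}) f"
    "h t = f \<beta> + (-1) *\<^sub>R incr ({t..<\<beta>} \<inter> {\<alpha><..<\<beta>}) h" if t: "t \<in> {\<alpha><..\<beta>}" for t
  proof -
    have "{t..<\<beta>} \<inter> {\<alpha><..<\<beta>} = {t..<\<beta>}" using t by auto
    moreover have "f \<beta> = f t + incr {t..<\<beta>} f" "f \<beta> = h t + incr {t..<\<beta>} h"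
      using solD(2)[OF f, of t \<beta>] solD(2)[OF h, of t \<beta>] t eq by auto
    ultimately show "f t = f \<beta> + (-1) *\<^sub>R incr ({t..<\<beta>} \<inter> {\<alpha><..<\<beta>}) f"
      "h t = f \<beta> + (-1) *\<^sub>R incr ({t..<\<beta>} \<inter> {\<alpha><..<\<beta>}) h"
      by (metis add_diff_cancel_right' scaleR_minus1_left uminus_add_conv_diff add.commute)+
  qed
qed (use t in auto)

text \<open>A solution to the right of \<alpha> extends to \<alpha> as soon as its right limit has a
  preimage \<open>d\<close> under the jump.\<close>

lemma sol_from_half_open:
  assumes f: "bmeas_pair {\<alpha><..\<beta>} f" and ival: "\<alpha> \<in> ival a b" "\<beta> \<in> ival a b" and d: "jump \<alpha> d = e"
    and eq: "\<And>t. t \<in> {\<alpha><..\<beta>} \<Longrightarrow> f t = e + incr {\<alpha><..<t} f"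
  shows "sol \<alpha> \<beta> (f(\<alpha> := d))"
proof (cases "\<alpha> \<le> \<beta>")
  case True
  define F where "F = f(\<alpha> := d)"
  have incr: "incr A F = incr A f" if "\<alpha> \<notin> A" for A
    by (rule incr_cong) (use that in \<open>auto simp: F_def\<close>)
  have un: "{\<alpha>..\<beta>} = {\<alpha>} \<union> {\<alpha><..\<beta>}" using True by auto
  have "bmeas_pair {\<alpha>} F"
    by (rule bmeas_pair_cong[OF bmeas_pair_const[of _ d]]) (auto simp: F_def)
  moreover have "bmeas_pair {\<alpha><..\<beta>} F"
    by (rule bmeas_pair_cong[OF f]) (auto simp: F_def)
  ultimately have bmeas: "bmeas_pair {\<alpha>..\<beta>} F" unfolding un by (intro bmeas_pair_Un) auto
  have F: "F t = jump \<alpha> (F \<alpha>) + incr {\<alpha><..<t} F" if "t \<in> {\<alpha><..\<beta>}" for t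
    using eq[OF that] that d by (simp add: incr) (simp add: F_def)
  have "sol \<alpha> \<beta> F"
    unfolding sol_def
  proof (intro conjI allI impI bmeas)
    fix x y assume xy: "\<alpha> \<le> x" "x \<le> y" "y \<le> \<beta>"
    consider "x = y" | "\<alpha> < x" "x < y" | "x = \<alpha>" "x < y" using xy by linarith
    then show "F y = F x + incr {x..<y} F"
    proof cases
      case 2
      have un: "{\<alpha><..<y} = {\<alpha><..<x} \<union> {x..<y}" using 2 by auto
      have "incr {\<alpha><..<y} F = incr {\<alpha><..<x} F + incr {x..<y} F"
        unfolding un by (rule incr_Un[where \<alpha> = \<alpha> and \<beta> = \<beta>, OF bmeas_pair_subset[OF bmeas]]) (use 2 xy ival in auto)
      then show ?thesis using F[of x] F[of y] 2 xy by simp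
    next
      case 3
      have un: "{\<alpha>..<y} = {\<alpha>} \<union> {\<alpha><..<y}" using 3 by auto
      have "incr {\<alpha>..<y} F = incr {\<alpha>} F + incr {\<alpha><..<y} F"
        unfolding un by (rule incr_Un[where \<alpha> = \<alpha> and \<beta> = \<beta>, OF bmeas_pair_subset[OF bmeas]]) (use 3 xy ival in auto)
      then show ?thesis using F[of y] 3 xy by (simp add: jump_eq_incr)
    qed simp
  qed
  then show ?thesis by (simp add: F_def)
next
  \<comment> \<open>The interval is empty. Including this case spares the callers an order
    hypothesis.\<close>
  case False
  have "bmeas_pair {\<alpha>..\<beta>} (f(\<alpha> := d))"
    by (rule bmeas_pair_cong[OF bmeas_pair_const[of _ 0]]) (use False in auto)
  then show ?thesis using False unfolding sol_def by (meson order_trans)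
qed

text \<open>Going right needs no condition on the jump: the initial value is pushed through it, and
  the Volterra equation starts from the result.\<close>

lemma local_exists_forward:
  assumes ival: "\<alpha> \<in> ival a b" "\<beta> \<in> ival a b" and small: "total_var {\<alpha><..<\<beta>} \<le> 1/2"
  obtains f where "sol \<alpha> \<beta> f" "f \<alpha> = d"
proof -
  obtain f where f: "bmeas_pair {\<alpha><..\<beta>} f"
    "\<And>t. t \<in> {\<alpha><..\<beta>} \<Longrightarrow> f t = jump \<alpha> d + 1 *\<^sub>R incr ({\<alpha><..<t} \<inter> {\<alpha><..<\<beta>}) f"
    by (rule volterra_exists[OF ival small sets_less_section(2)[of \<alpha> \<alpha> \<beta>], of 1 "jump \<alpha> d"]) auto
  have "f t = jump \<alpha> d + incr {\<alpha><..<t} f" if t: "t \<in> {\<alpha><..\<beta>}" for t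
  proof -
    have "{\<alpha><..<t} \<inter> {\<alpha><..<\<beta>} = {\<alpha><..<t}" using t by auto
    then show ?thesis using f(2)[OF t] by simp
  qed
  then have "sol \<alpha> \<beta> (f(\<alpha> := d))" by (intro sol_from_half_open[OF f(1) ival refl])
  then show thesis by (rule that) simp
qed

text \<open>Going left, the Volterra equation reaches every point except \<alpha>; surjectivity of
  the jump supplies the value there.\<close>

lemma local_exists_backward:
  assumes ival: "\<alpha> \<in> ival a b" "\<beta> \<in> ival a b" and less: "\<alpha> < \<beta>"
    and small: "total_var {\<alpha><..<\<beta>} \<le> 1/2" and surj: "surj (jump \<alpha>)"
  obtains f where "sol \<alpha> \<beta> f" "f \<beta> = d"
proof -
  obtain f where f: "bmeas_pair {\<alpha><..\<beta>} f"
    "\<And>t. t \<in> {\<alpha><..\<beta>} \<Longrightarrow> f t = d + (-1) *\<^sub>R incr ({t..<\<beta>} \<inter> {\<alpha><..<\<beta>}) f"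
    by (rule volterra_exists[OF ival small sets_less_section(3)[of \<beta> \<alpha>], of "-1" d]) auto
  have sub: "{t..<\<beta>} \<inter> {\<alpha><..<\<beta>} = {t..<\<beta>}" if "t \<in> {\<alpha><..\<beta>}" for t using that by auto
  \<comment> \<open>This is the right limit at \<alpha>, found by running the equation back from
    \<beta>.\<close>
  define e where "e = d - incr {\<alpha><..<\<beta>} f"
  obtain d' where d': "jump \<alpha> d' = e" using surj by (metis surjD)
  have eq: "f t = e + incr {\<alpha><..<t} f" if t: "t \<in> {\<alpha><..\<beta>}" for t
  proof -
    have un: "{\<alpha><..<\<beta>} = {\<alpha><..<t} \<union> {t..<\<beta>}" using t by auto
    have "incr {\<alpha><..<\<beta>} f = incr {\<alpha><..<t} f + incr {t..<\<beta>} f"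
      unfolding un by (rule incr_Un[where \<alpha> = \<alpha> and \<beta> = \<beta>, OF bmeas_pair_subset[OF f(1)]]) (use t ival in auto)
    then show ?thesis using f(2)[OF t] sub[OF t] by (simp add: e_def)
  qed
  have "sol \<alpha> \<beta> (f(\<alpha> := d'))" by (rule sol_from_half_open[OF f(1) ival d' eq])
  moreover have "(f(\<alpha> := d')) \<beta> = d" using f(2)[of \<beta>] less by simp
  ultimately show thesis by (rule that)
qed

text \<open>A point mass at \<open>p\<close> may keep the variation of every interval around
  \<open>p\<close> large, so the two sides are bounded separately.\<close>

lemma small_total_var_near:
  assumes p: "p \<in> ival a b"
  obtains d where "d > 0"
    "\<And>\<alpha> \<beta>. \<alpha> \<le> p \<Longrightarrow> p \<le> \<beta> \<Longrightarrow> \<beta> - \<alpha> < d \<Longrightarrow>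
      \<alpha> \<in> ival a b \<and> \<beta> \<in> ival a b \<and> total_var {\<alpha><..<p} \<le> 1/2 \<and> total_var {p<..<\<beta>} \<le> 1/2"
proof -
  obtain d0 where d0: "d0 > 0" "{p - d0..p + d0} \<subseteq> ival a b" using ival_ball[OF p] by blast
  let ?B = "\<lambda>d. {p - d..p + d} - {p}"
  \<comment> \<open>Each of the three terms of \<open>total_var\<close> gets the share 1/6. Adding 1
    to \<open>norm z\<close> avoids a division by zero for \<open>z = 0\<close>.\<close>
  define e where "e = 1 / (6 * (norm z + 1))"
  have e: "e > 0" by (simp add: e_def add_nonneg_pos)
  have "\<forall>\<^sub>F d in at_right 0. d < d0"
    using d0(1) by (simp add: eventually_at_right_less order_tendstoD(2)[OF tendsto_ident_at])
  then have ev: "\<forall>\<^sub>F d in at_right 0. 0 < d \<and> d < d0 \<and> measure (var \<sigma>) (?B d) < 1/6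
      \<and> measure (var \<kappa>) (?B d) < 1/6 \<and> measure (var \<rho>) (?B d) < e"
    using eventually_at_right_less[of 0] s.eventually_measure_punctured[OF p, of "1/6"]
      k.eventually_measure_punctured[OF p, of "1/6"] r.eventually_measure_punctured[OF p e]
    by (intro eventually_conj) simp_all
  obtain d where d: "0 < d" "d < d0" and m: "measure (var \<sigma>) (?B d) < 1/6"
      "measure (var \<kappa>) (?B d) < 1/6" "measure (var \<rho>) (?B d) < e"
    using eventually_happens'[OF trivial_limit_at_right_real ev] by blast
  have pd: "p - d \<in> ival a b" "p + d \<in> ival a b" using d d0(2) by auto
  have "norm z * measure (var \<rho>) (?B d) \<le> norm z * e" using m(3) by (intro mult_left_mono) auto
  also have "norm z * e \<le> 1/6"
    unfolding e_def by (simp add: divide_simps add_nonneg_pos)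
  finally have B: "total_var (?B d) \<le> 1/2" using m by (simp add: total_var_def)
  show thesis
  proof (rule that[OF d(1)], intro conjI)
    fix \<alpha> \<beta> assume *: "\<alpha> \<le> p" "p \<le> \<beta>" "\<beta> - \<alpha> < d"
    then show "\<alpha> \<in> ival a b" "\<beta> \<in> ival a b" using ival_Icc_subset[OF pd] by auto
    have "total_var {\<alpha><..<p} \<le> total_var (?B d)" "total_var {p<..<\<beta>} \<le> total_var (?B d)"
      by (rule total_var_mono[OF pd]; use * in auto)+
    then show "total_var {\<alpha><..<p} \<le> 1/2" "total_var {p<..<\<beta>} \<le> 1/2" using B by auto
  qed
qed

section \<open>Existence and uniqueness on compact intervals by bisection\<close>

definition regular :: bool where
  "regular \<longleftrightarrow> (\<forall>x\<in>ival a b. bij (jump x))"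

text \<open>Solvability from either endpoint passes to a union of adjacent intervals by gluing and
  holds on all small intervals around any point, so bisection applies. Surjectivity of the jumps
  enters only in the leftward direction.\<close>

lemma exists_on_Icc:
  assumes reg: "regular" and "\<alpha> \<le> \<beta>" "\<alpha> \<in> ival a b" "\<beta> \<in> ival a b"
  shows "(\<forall>d. \<exists>f. sol \<alpha> \<beta> f \<and> f \<alpha> = d) \<and> (\<forall>d. \<exists>f. sol \<alpha> \<beta> f \<and> f \<beta> = d)"
proof -
  \<comment> \<open>Bisection quantifies over arbitrary reals, hence the membership guards inside
    \<open>P\<close>.\<close>
  define P where "P x y \<longleftrightarrow> x \<in> ival a b \<longrightarrow> y \<in> ival a b \<longrightarrow>
    (\<forall>d. \<exists>f. sol x y f \<and> f x = d) \<and> (\<forall>d. \<exists>f. sol x y f \<and> f y = d)" for x y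
  have trans: "P x w" if xy: "P x y" and yw: "P y w" and le: "x \<le> y" "y \<le> w" for x y w
    unfolding P_def
  proof (intro impI conjI allI)
    fix d assume ival: "x \<in> ival a b" "w \<in> ival a b"
    then have y: "y \<in> ival a b" using ival_Icc_subset[OF ival] le by auto
    obtain f1 where f1: "sol x y f1" "f1 x = d" using xy ival y unfolding P_def by blast
    obtain h1 where h1: "sol y w h1" "h1 y = f1 y" using yw ival y unfolding P_def by blast
    show "\<exists>f. sol x w f \<and> f x = d"
      using sol_glue[OF f1(1) h1(1) h1(2)[symmetric] ival le] f1 le by force
    obtain h2 where h2: "sol y w h2" "h2 w = d" using yw ival y unfolding P_def by blast
    obtain f2 where f2: "sol x y f2" "f2 y = h2 y" using xy ival y unfolding P_def by blast
    have "(if w \<le> y then f2 w else h2 w) = d" using h2 f2 le by (cases "w = y") auto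
    then show "\<exists>f. sol x w f \<and> f w = d"
      using sol_glue[OF f2(1) h2(1) f2(2) ival le] by force
  qed
  have step: "P x y" if le: "x \<le> y" and small: "total_var {x<..<y} \<le> 1/2" for x y
    unfolding P_def
  proof (intro impI)
    assume ival: "x \<in> ival a b" "y \<in> ival a b"
    have fwd: "\<exists>f. sol x y f \<and> f x = d" for d using local_exists_forward[OF ival small] by metis
    show "(\<forall>d. \<exists>f. sol x y f \<and> f x = d) \<and> (\<forall>d. \<exists>f. sol x y f \<and> f y = d)"
    proof (cases "x = y")
      case False
      then have "x < y" using le by simp
      then have "\<exists>f. sol x y f \<and> f y = d" for d
        using local_exists_backward[OF ival _ small] reg ival unfolding regular_def bij_def by metis
      with fwd show ?thesis by blast
    qed (use fwd in auto)
  qed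
  have "P \<alpha> \<beta>"
    using \<open>\<alpha> \<le> \<beta>\<close>
  proof (rule Bolzano)
    show "P x w" if "P x y" "P y w" "x \<le> y" "y \<le> w" for x y w using trans that .
    fix p assume "\<alpha> \<le> p" "p \<le> \<beta>"
    then have "p \<in> ival a b" using ival_Icc_subset[OF assms(3,4)] by auto
    then obtain d where d: "d > 0" "\<And>x y. x \<le> p \<Longrightarrow> p \<le> y \<Longrightarrow> y - x < d \<Longrightarrow>
        x \<in> ival a b \<and> y \<in> ival a b \<and> total_var {x<..<p} \<le> 1/2 \<and> total_var {p<..<y} \<le> 1/2"
      by (rule small_total_var_near) blast
    \<comment> \<open>The interval is cut at \<open>p\<close>, because only its two sides are known
      to have small variation.\<close>
    have "P x y" if "x \<le> p" "p \<le> y" "y - x < d" for x y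
      using trans[of x p y] step[of x p] step[of p y] d(2)[OF that] that by blast
    then show "\<exists>d>0. \<forall>x y. x \<le> p \<and> p \<le> y \<and> y - x < d \<longrightarrow> P x y" using d(1) by blast
  qed
  then show ?thesis using assms unfolding P_def by blast
qed

text \<open>Equivalence of agreement at the two endpoints is transitive along adjacent intervals,
  which makes it fit for bisection. Agreement at inner points then follows by restriction to
  subintervals.\<close>

lemma endpoint_unique:
  assumes reg: "regular" and "\<alpha> \<le> \<beta>" "\<alpha> \<in> ival a b" "\<beta> \<in> ival a b" "sol \<alpha> \<beta> f" "sol \<alpha> \<beta> h"
  shows "f \<alpha> = h \<alpha> \<longleftrightarrow> f \<beta> = h \<beta>"
proof -
  define P where "P x y \<longleftrightarrow> x \<in> ival a b \<longrightarrow> y \<in> ival a b \<longrightarrow>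
    (\<forall>f h. sol x y f \<longrightarrow> sol x y h \<longrightarrow> (f x = h x \<longleftrightarrow> f y = h y))" for x y
  have trans: "P x w" if xy: "P x y" and yw: "P y w" and le: "x \<le> y" "y \<le> w" for x y w
    unfolding P_def
  proof (intro impI allI)
    fix f h assume ival: "x \<in> ival a b" "w \<in> ival a b" and *: "sol x w f" "sol x w h"
    then have y: "y \<in> ival a b" using ival_Icc_subset[OF ival] le by auto
    have "sol x y f" "sol x y h" "sol y w f" "sol y w h" using * le by (auto intro: sol_subinterval)
    then show "f x = h x \<longleftrightarrow> f w = h w" using xy yw ival y unfolding P_def by blast
  qed
  have step: "P x y" if le: "x \<le> y" and small: "total_var {x<..<y} \<le> 1/2" for x y
    unfolding P_def
  proof (intro impI allI)
    fix f h assume ival: "x \<in> ival a b" "y \<in> ival a b" and *: "sol x y f" "sol x y h"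
    show "f x = h x \<longleftrightarrow> f y = h y"
    proof (cases "x = y")
      case False
      then have y: "y \<in> {x<..y}" using le by simp
      have "f x = h x" if eq: "f y = h y"
      proof -
        have "f t = h t" if "t \<in> {x<..y}" for t
          using local_unique_backward[OF * ival small eq that] .
        then have "incr {x<..<y} f = incr {x<..<y} h" by (intro incr_cong) auto
        \<comment> \<open>Agreement to the right of \<open>x\<close> forces equal right limits at
          \<open>x\<close>; injectivity of the jump carries this over to the values.\<close>
        then have "jump x (f x) = jump x (h x)"
          using sol_jump[OF *(1) ival y] sol_jump[OF *(2) ival y] eq by simp
        then show ?thesis using reg ival unfolding regular_def bij_def inj_def by blast
      qed
      then show ?thesis using local_unique_forward[OF * ival small _ y] by auto
    qed simp
  qed
  have "P \<alpha> \<beta>"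
    using \<open>\<alpha> \<le> \<beta>\<close>
  proof (rule Bolzano)
    show "P x w" if "P x y" "P y w" "x \<le> y" "y \<le> w" for x y w using trans that .
    fix p assume "\<alpha> \<le> p" "p \<le> \<beta>"
    then have "p \<in> ival a b" using ival_Icc_subset[OF assms(3,4)] by auto
    then obtain d where d: "d > 0" "\<And>x y. x \<le> p \<Longrightarrow> p \<le> y \<Longrightarrow> y - x < d \<Longrightarrow>
        x \<in> ival a b \<and> y \<in> ival a b \<and> total_var {x<..<p} \<le> 1/2 \<and> total_var {p<..<y} \<le> 1/2"
      by (rule small_total_var_near) blast
    have "P x y" if "x \<le> p" "p \<le> y" "y - x < d" for x y
      using trans[of x p y] step[of x p] step[of p y] d(2)[OF that] that by blast
    then show "\<exists>d>0. \<forall>x y. x \<le> p \<and> p \<le> y \<and> y - x < d \<longrightarrow> P x y" using d(1) by blast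
  qed
  then show ?thesis using assms unfolding P_def by blast
qed

text \<open>The endpoint equivalence is applied to the interval between \<open>c\<close> and
  \<open>t\<close>, on whichever side \<open>t\<close> lies.\<close>

lemma sol_unique:
  assumes reg: "regular" and ival: "\<alpha> \<in> ival a b" "\<beta> \<in> ival a b"
    and f: "sol \<alpha> \<beta> f" and h: "sol \<alpha> \<beta> h" and c: "c \<in> {\<alpha>..\<beta>}" "f c = h c" and t: "t \<in> {\<alpha>..\<beta>}"
  shows "f t = h t"
proof -
  have ct: "c \<in> ival a b" "t \<in> ival a b" using ival_Icc_subset[OF ival] c t by blast+
  show ?thesis
  proof (cases "c \<le> t")
    case True
    then show ?thesis
      using endpoint_unique[OF reg True ct, of f h] sol_subinterval[OF f, of c t]
        sol_subinterval[OF h, of c t] c t by simp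
  next
    case False
    then show ?thesis
      using endpoint_unique[OF reg _ ct(2,1), of f h] sol_subinterval[OF f, of t c]
        sol_subinterval[OF h, of t c] c t by simp
  qed
qed

section \<open>Solutions on all of (a,b)\<close>

definition global_sol :: "(real \<Rightarrow> complex \<times> complex) \<Rightarrow> bool" where
  "global_sol f \<longleftrightarrow> (\<forall>\<alpha>\<in>ival a b. \<forall>\<beta>\<in>ival a b. sol \<alpha> \<beta> f)"

lemma global_sol_unique:
  assumes "regular" "global_sol f" "global_sol h" "c \<in> ival a b" "f c = h c" "t \<in> ival a b"
  shows "f t = h t"
  using assms sol_unique[of "min c t" "max c t" f h c t] unfolding global_sol_def
  by (cases "c \<le> t") (auto simp: min_def max_def)

text \<open>By uniqueness the solutions on compact intervals containing \<open>c\<close> are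
  compatible, so they patch together.\<close>

lemma global_sol_exists:
  assumes reg: "regular" and c: "c \<in> ival a b"
  obtains f where "global_sol f" "f c = d"
proof -
  have "\<exists>f. sol \<alpha> \<beta> f \<and> f c = d"
    if ab: "\<alpha> \<in> ival a b" "\<beta> \<in> ival a b" "\<alpha> \<le> c" "c \<le> \<beta>" for \<alpha> \<beta>
  proof -
    obtain f where f: "sol \<alpha> c f" "f c = d" using exists_on_Icc[OF reg, of \<alpha> c] c ab by blast
    obtain h where h: "sol c \<beta> h" "h c = d" using exists_on_Icc[OF reg, of c \<beta>] c ab by blast
    have "sol \<alpha> \<beta> (\<lambda>t. if t \<le> c then f t else h t)"
      using sol_glue[OF f(1) h(1)] f(2) h(2) ab by simp
    then show ?thesis using f(2) by (intro exI[of _ "\<lambda>t. if t \<le> c then f t else h t"]) simp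
  qed
  then obtain S where S: "\<And>\<alpha> \<beta>. \<alpha> \<in> ival a b \<Longrightarrow> \<beta> \<in> ival a b \<Longrightarrow> \<alpha> \<le> c \<Longrightarrow> c \<le> \<beta> \<Longrightarrow>
      sol \<alpha> \<beta> (S \<alpha> \<beta>) \<and> S \<alpha> \<beta> c = d" by metis
  \<comment> \<open>The value at \<open>t\<close> is read off from the smallest interval that
    contains both \<open>c\<close> and \<open>t\<close>.\<close>
  define f where "f t = S (min c t) (max c t) t" for t
  have sol: "sol \<alpha> \<beta> f" if ab: "\<alpha> \<in> ival a b" "\<beta> \<in> ival a b" "\<alpha> \<le> c" "c \<le> \<beta>" for \<alpha> \<beta>
  proof (rule sol_cong)
    show "sol \<alpha> \<beta> (S \<alpha> \<beta>)" using S ab by blast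
    fix t assume t: "t \<in> {\<alpha>..\<beta>}"
    have ival: "min c t \<in> ival a b" "max c t \<in> ival a b"
      using ival_Icc_subset[OF ab(1,2)] t ab by (auto simp: min_def max_def)
    have "sol (min c t) (max c t) (S \<alpha> \<beta>)"
      using sol_subinterval[of \<alpha> \<beta> "S \<alpha> \<beta>" "min c t" "max c t"] S[OF ab] t ab by simp
    moreover have "sol (min c t) (max c t) (S (min c t) (max c t))" "S (min c t) (max c t) c = d"
      using S[OF ival] by simp_all
    ultimately show "S \<alpha> \<beta> t = f t"
      using sol_unique[OF reg ival, of "S \<alpha> \<beta>" "S (min c t) (max c t)" c t] S[OF ab]
      by (simp add: f_def)
  qed
  have "global_sol f"
    unfolding global_sol_def
  proof (intro ballI)
    fix \<alpha> \<beta> assume "\<alpha> \<in> ival a b" "\<beta> \<in> ival a b"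
    \<comment> \<open>An arbitrary interval is first enlarged so as to contain
      \<open>c\<close>.\<close>
    then have "sol (min \<alpha> c) (max \<beta> c) f" using c by (intro sol) (auto simp: min_def max_def)
    then show "sol \<alpha> \<beta> f" by (rule sol_subinterval) auto
  qed
  moreover have "f c = d" using S[OF c c] by (simp add: f_def)
  ultimately show thesis by (rule that)
qed

section \<open>Initial value problems\<close>

text \<open>Together with \<open>global_sol_imp_ivp_solution\<close> this translates the initial
  value problem, with its almost everywhere conditions, into the pointwise integral system.\<close>

lemma ivp_solution_imp_global_sol:
  assumes c: "c \<in> ival a b" and u: "ivp_solution a b \<rho> \<sigma> \<kappa> g z c d1 d2 u"
  obtains w where "global_sol (\<lambda>t. (u t, w t))" "u c = d1" "w c = d2"
proof -
  obtain F k h where h: "L1loc a b \<sigma> h" and u: "\<And>x. x \<in> ival a b \<Longrightarrow> u x = u c + cint \<sigma> c x h"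
    and k: "L1loc a b \<rho> k" and F: "\<And>x. x \<in> ival a b \<Longrightarrow> F x = F c + cint \<rho> c x k"
    and aeh: "AE x in var \<sigma>. x \<in> ival a b \<longrightarrow> F x = - h x + cint \<kappa> c x u"
    and aek: "AE x in var \<rho>. x \<in> ival a b \<longrightarrow> k x - z * u x = g x"
    and ic: "u c = d1" "cint \<kappa> c c u - F c = d2"
    using u unfolding ivp_solution_def Dtau_rep_def AC_with_def by blast
  \<comment> \<open>This is the quasi-derivative, an everywhere defined representative of
    \<open>h\<close>.\<close>
  define w where "w x = cint \<kappa> c x u - F x" for x
  have bmeas_u: "bmeas {\<alpha>..\<beta>} u" if ab: "\<alpha> \<in> ival a b" "\<beta> \<in> ival a b" for \<alpha> \<beta>
  proof (rule bmeas_cong)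
    show "bmeas {\<alpha>..\<beta>} (\<lambda>x. u c + cint \<sigma> c x h)"
      by (intro bmeas_add bmeas_const s.bmeas_cint h c ab) simp
  qed (use u ival_Icc_subset[OF ab] in force)
  have bmeas_F: "bmeas {\<alpha>..\<beta>} F" if ab: "\<alpha> \<in> ival a b" "\<beta> \<in> ival a b" for \<alpha> \<beta>
  proof (rule bmeas_cong)
    show "bmeas {\<alpha>..\<beta>} (\<lambda>x. F c + cint \<rho> c x k)"
      by (intro bmeas_add bmeas_const r.bmeas_cint k c ab) simp
  qed (use F ival_Icc_subset[OF ab] in force)
  have L1u: "L1loc a b \<kappa> u" using bmeas_u by (rule k.bmeas_L1loc[OF c])
  have "sol \<alpha> \<beta> (\<lambda>t. (u t, w t))" if ab: "\<alpha> \<in> ival a b" "\<beta> \<in> ival a b" for \<alpha> \<beta>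
    unfolding sol_def
  proof (intro conjI allI impI)
    have "bmeas {\<alpha>..\<beta>} w"
      unfolding w_def by (intro bmeas_diff k.bmeas_cint L1u c ab bmeas_F)
    then show bmeas: "bmeas_pair {\<alpha>..\<beta>} (\<lambda>t. (u t, w t))"
      using bmeas_u[OF ab] by (simp add: bmeas_pair_def)
    fix x y assume xy: "\<alpha> \<le> x" "x \<le> y" "y \<le> \<beta>"
    have ival: "x \<in> ival a b" "y \<in> ival a b" using ival_Icc_subset[OF ab] xy by auto
    have sub: "{x..<y} \<subseteq> {\<alpha>..\<beta>}" using xy by auto
    have sub': "{x..<y} \<subseteq> ival a b" using ival_Icc_subset[OF ival] by auto
    have "bmeas_pair {x..<y} (\<lambda>t. (u t, w t))" using bmeas_pair_subset[OF bmeas sub] by simp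
    note i = bmeas_pair_integrable[OF this sub ab, simplified]
    have "u y - u x = cmint \<sigma> {x..<y} h"
      using u[OF ival(1)] u[OF ival(2)] s.cint_split[OF h c ival xy(2)] by simp
    \<comment> \<open>The functions \<open>h\<close> and \<open>w\<close> agree almost everywhere
      for the variation of \<sigma>, which is the measure integrated against; likewise
      \<open>k\<close> is replaced below under \<rho>.\<close>
    also have "\<dots> = cmint \<sigma> {x..<y} w"
    proof (rule s.cmint_cong_AE)
      show "AE t in var \<sigma>. t \<in> {x..<y} \<longrightarrow> h t = w t"
        using aeh by eventually_elim (use sub' in \<open>auto simp: w_def\<close>)
    qed (use i s.L1loc_set_integrable[OF h ab sub] in auto)
    finally have 1: "u y = u x + cmint \<sigma> {x..<y} w" by (simp add: algebra_simps)
    have "w y - w x = cmint \<kappa> {x..<y} u - cmint \<rho> {x..<y} k"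
      using F[OF ival(1)] F[OF ival(2)] r.cint_split[OF k c ival xy(2)]
        k.cint_split[OF L1u c ival xy(2)] by (simp add: w_def algebra_simps)
    also have "cmint \<rho> {x..<y} k = cmint \<rho> {x..<y} (\<lambda>t. z * u t + g t)"
    proof (rule r.cmint_cong_AE)
      show "AE t in var \<rho>. t \<in> {x..<y} \<longrightarrow> k t = z * u t + g t"
        using aek by eventually_elim (use sub' in \<open>auto simp: algebra_simps\<close>)
    qed (use i r.L1loc_set_integrable[OF k ab sub] in auto)
    finally have 2: "w y = w x + (cmint \<kappa> {x..<y} u - cmint \<rho> {x..<y} (\<lambda>t. z * u t + g t))"
      by (simp add: algebra_simps)
    show "(u y, w y) = (u x, w x) + incr {x..<y} (\<lambda>t. (u t, w t))"
      using 1 2 by (simp add: incr_def)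
  qed
  then have "global_sol (\<lambda>t. (u t, w t))" unfolding global_sol_def by blast
  then show thesis by (rule that) (use ic in \<open>simp_all add: w_def\<close>)
qed

text \<open>Taking \<open>w\<close> as derivative of \<open>u\<close> and \<open>z u + g\<close> as
  derivative of \<open>F\<close>, the almost everywhere conditions hold at every point. The integral
  from \<open>c\<close> to \<open>c\<close> vanishes, so the quasi-derivative at \<open>c\<close> is
  \<open>w c\<close>.\<close>

lemma global_sol_imp_ivp_solution:
  assumes c: "c \<in> ival a b" and f: "global_sol (\<lambda>t. (u t, w t))"
  shows "ivp_solution a b \<rho> \<sigma> \<kappa> g z c (u c) (w c) u"
proof -
  define F where "F x = cint \<kappa> c x u - w x" for x
  have bmeas: "bmeas {\<alpha>..\<beta>} u" "bmeas {\<alpha>..\<beta>} w" if "\<alpha> \<in> ival a b" "\<beta> \<in> ival a b" for \<alpha> \<beta>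
    using f that solD(1) unfolding global_sol_def bmeas_pair_def by force+
  have inc: "u y = u x + cmint \<sigma> {x..<y} w"
    "w y = w x + (cmint \<kappa> {x..<y} u - cmint \<rho> {x..<y} (\<lambda>t. z * u t + g t))"
    if "x \<in> ival a b" "y \<in> ival a b" "x \<le> y" for x y
  proof -
    have "sol x y (\<lambda>t. (u t, w t))" using f that unfolding global_sol_def by blast
    from solD(2)[OF this order_refl that(3) order_refl]
    show "u y = u x + cmint \<sigma> {x..<y} w"
      "w y = w x + (cmint \<kappa> {x..<y} u - cmint \<rho> {x..<y} (\<lambda>t. z * u t + g t))"
      by (simp_all add: incr_def)
  qed
  have 1: "AC_with a b \<sigma> c u w"
    unfolding AC_with_def
  proof (intro conjI ballI)
    show "L1loc a b \<sigma> w" using bmeas(2) by (rule s.bmeas_L1loc[OF c])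
    fix x assume "x \<in> ival a b"
    then show "u x = u c + cint \<sigma> c x w"
      using inc(1)[of c x] inc(1)[of x c] c by (simp add: cint_eq_cmint)
  qed
  have 2: "AC_with a b \<rho> c F (\<lambda>t. z * u t + g t)"
    unfolding AC_with_def
  proof (intro conjI ballI)
    have "L1loc a b \<rho> u" using bmeas(1) by (rule r.bmeas_L1loc[OF c])
    then show "L1loc a b \<rho> (\<lambda>t. z * u t + g t)"
      using g unfolding L1loc_def
      by (intro allI impI set_integral_add(1) set_integrable_mult_right) simp_all
    fix x assume "x \<in> ival a b"
    then show "F x = F c + cint \<rho> c x (\<lambda>t. z * u t + g t)"
      using inc(2)[of c x] inc(2)[of x c] c by (simp add: F_def cint_eq_cmint)
  qed
  have "Dtau_rep a b \<rho> \<sigma> \<kappa> c u F (\<lambda>t. z * u t + g t)"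
    unfolding Dtau_rep_def using 1 2 by (intro exI[of _ w]) (simp add: F_def)
  then show ?thesis
    unfolding ivp_solution_def
    by (intro exI[of _ F] exI[of _ "\<lambda>t. z * u t + g t"]) (simp add: F_def)
qed

section \<open>The jump map, its degeneration, and complex conjugation\<close>

text \<open>The linear part has the rows (1, s) and (q, 1) with \<open>q = k - z * r\<close>, hence
  determinant \<open>1 - s * q\<close>. Since \<open>r * s = 0\<close>, the parameter
  \<open>z\<close> drops out of \<open>s * q\<close>, leaving \<open>s * k\<close>, which differs
  from 1.\<close>

lemma bij_jump:
  assumes "cmeasure \<rho> {x} * cmeasure \<sigma> {x} = 0" "cmeasure \<kappa> {x} * cmeasure \<sigma> {x} \<noteq> 1"
  shows "bij (jump x)"
proof -
  define r s k where "r = cmeasure \<rho> {x}" and "s = cmeasure \<sigma> {x}" and "k = cmeasure \<kappa> {x}"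
  define q where "q = k - z * r"
  have jump: "jump x (v, w) = (v + w * s, w + v * q - g x * r)" for v w
    by (simp add: jump_def r_def s_def k_def q_def algebra_simps)
  have "s * q = s * k - z * (r * s)" by (simp add: q_def algebra_simps)
  then have q: "1 - s * q \<noteq> 0" using assms by (simp only: r_def s_def k_def) (simp add: mult.commute)
  have "inj (jump x)"
  proof (rule injI)
    fix p p' assume "jump x p = jump x p'"
    moreover obtain v w v' w' where p: "p = (v, w)" "p' = (v', w')" by fastforce
    ultimately have e: "v + w * s = v' + w' * s" "w + v * q = w' + v' * q"
      by (simp_all add: jump)
    then have d: "v - v' = - (w - w') * s" "w - w' = - (v - v') * q" by (simp_all add: algebra_simps)
    then have "(v - v') * (1 - s * q) = 0" by (simp add: algebra_simps)
    then have "v = v'" using q by simp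
    with e show "p = p'" by (simp add: p)
  qed
  moreover have "surj (jump x)"
  proof (rule surj_def[THEN iffD2, rule_format])
    fix e :: "complex \<times> complex"
    \<comment> \<open>\<open>e2\<close> is the second coordinate freed from the inhomogeneous shift;
      \<open>v\<close> is then given by Cramer's rule.\<close>
    define e2 where "e2 = snd e + g x * r"
    define v where "v = (fst e - s * e2) / (1 - s * q)"
    have "v * (1 - s * q) = fst e - s * e2" using q by (simp add: v_def)
    then have "v + (e2 - v * q) * s = fst e" by (simp add: algebra_simps)
    then have "e = jump x (v, e2 - v * q)" by (simp add: jump e2_def prod_eq_iff)
    then show "\<exists>p. e = jump x p" ..
  qed
  ultimately show ?thesis by (simp add: bij_def)
qed

text \<open>Two solutions with different values at \<open>x\<close> but equal right limits there
  merge to the right of \<open>x\<close>. Hence uniqueness fails for a base point chosen to the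
  right of \<open>x\<close>, not for \<open>x\<close> itself.\<close>

lemma singular_jump_nonunique:
  assumes x: "x \<in> ival a b"
    and sing: "cmeasure \<sigma> {x} * (cmeasure \<kappa> {x} - z * cmeasure \<rho> {x}) = 1"
    and ex: "\<And>d1 d2. \<exists>u. ivp_solution a b \<rho> \<sigma> \<kappa> g z x d1 d2 u"
  obtains c d1 d2 u v where "c \<in> ival a b" "ivp_solution a b \<rho> \<sigma> \<kappa> g z c d1 d2 u"
    "ivp_solution a b \<rho> \<sigma> \<kappa> g z c d1 d2 v" "u x \<noteq> v x"
proof -
  let ?s = "cmeasure \<sigma> {x}"
  obtain u1 where "ivp_solution a b \<rho> \<sigma> \<kappa> g z x 0 0 u1" using ex by blast
  then obtain w1 where 1: "global_sol (\<lambda>t. (u1 t, w1 t))" "u1 x = 0" "w1 x = 0"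
    by (rule ivp_solution_imp_global_sol[OF x])
  \<comment> \<open>The vector (s, -1) lies in the kernel of the linear part of the jump:
    \<open>s - s = 0\<close>, and \<open>-1 + s * q = 0\<close> by singularity.\<close>
  obtain u2 where "ivp_solution a b \<rho> \<sigma> \<kappa> g z x ?s (-1) u2" using ex by blast
  then obtain w2 where 2: "global_sol (\<lambda>t. (u2 t, w2 t))" "u2 x = ?s" "w2 x = -1"
    by (rule ivp_solution_imp_global_sol[OF x])
  obtain d where d: "d > 0" "\<And>\<alpha> \<beta>. \<alpha> \<le> x \<Longrightarrow> x \<le> \<beta> \<Longrightarrow> \<beta> - \<alpha> < d \<Longrightarrow>
      \<alpha> \<in> ival a b \<and> \<beta> \<in> ival a b \<and> total_var {\<alpha><..<x} \<le> 1/2 \<and> total_var {x<..<\<beta>} \<le> 1/2"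
    by (rule small_total_var_near[OF x]) blast
  define c where "c = x + d / 2"
  have c: "c \<in> ival a b" "total_var {x<..<c} \<le> 1/2" "c \<in> {x<..c}"
    using d(2)[of x c] d(1) by (auto simp: c_def)
  have "jump x (0, 0) = jump x (?s, -1)"
    using sing by (simp add: jump_def algebra_simps)
  then have "(u1 c, w1 c) = (u2 c, w2 c)"
    using local_unique_forward[OF _ _ x c(1,2) _ c(3), of "\<lambda>t. (u1 t, w1 t)" "\<lambda>t. (u2 t, w2 t)"]
      1 2 x c(1) unfolding global_sol_def by simp
  then have "ivp_solution a b \<rho> \<sigma> \<kappa> g z c (u1 c) (w1 c) u1"
    "ivp_solution a b \<rho> \<sigma> \<kappa> g z c (u1 c) (w1 c) u2"
    using global_sol_imp_ivp_solution[OF c(1) 1(1)] global_sol_imp_ivp_solution[OF c(1) 2(1)] by auto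
  \<comment> \<open>The singularity equation forces the mass of \<sigma> at \<open>x\<close> to be
    nonzero.\<close>
  moreover have "u1 x \<noteq> u2 x" using 1 2 sing by auto
  ultimately show thesis using c(1) that by blast
qed

text \<open>With real measures, real \<open>z\<close> and almost everywhere real \<open>g\<close>,
  conjugation commutes with each integral of the system.\<close>

lemma global_sol_cnj:
  assumes re: "real_cmeasure a b \<rho>" "real_cmeasure a b \<sigma>" "real_cmeasure a b \<kappa>"
    and g_real: "AE x in var \<rho>. x \<in> ival a b \<longrightarrow> g x \<in> \<real>" and z: "z \<in> \<real>"
    and f: "global_sol (\<lambda>t. (u t, w t))"
  shows "global_sol (\<lambda>t. (cnj (u t), cnj (w t)))"
  unfolding global_sol_def sol_def
proof (intro ballI conjI allI impI)
  fix \<alpha> \<beta> assume ab: "\<alpha> \<in> ival a b" "\<beta> \<in> ival a b"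
  have sol: "sol \<alpha> \<beta> (\<lambda>t. (u t, w t))" using f ab unfolding global_sol_def by blast
  have bmeas_cnj: "bmeas S (\<lambda>t. cnj (v t))" if "bmeas S v" for S v
  proof -
    have m: "(\<lambda>t. indicator S t *\<^sub>R v t) \<in> borel_measurable borel"
      using that unfolding bmeas_def set_borel_measurable_def by simp
    have "(\<lambda>t. cnj (indicator S t *\<^sub>R v t)) \<in> borel_measurable borel"
      by (intro measurable_compose[OF m] borel_measurable_continuous_onI continuous_intros)
    then show ?thesis
      using that unfolding bmeas_def set_borel_measurable_def by (simp add: bounded_iff)
  qed
  show bmeas: "bmeas_pair {\<alpha>..\<beta>} (\<lambda>t. (cnj (u t), cnj (w t)))"
    using solD(1)[OF sol] bmeas_cnj by (simp add: bmeas_pair_def)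
  fix x y assume xy: "\<alpha> \<le> x" "x \<le> y" "y \<le> \<beta>"
  have ival: "x \<in> ival a b" "y \<in> ival a b" using ival_Icc_subset[OF ab] xy by auto
  have sub: "{x..<y} \<subseteq> {\<alpha>..\<beta>}" using xy by auto
  have sub': "{x..<y} \<subseteq> ival a b" using ival_Icc_subset[OF ival] by auto
  have "bmeas_pair {x..<y} (\<lambda>t. (u t, w t))" "bmeas_pair {x..<y} (\<lambda>t. (cnj (u t), cnj (w t)))"
    using bmeas_pair_subset[OF solD(1)[OF sol] sub] bmeas_pair_subset[OF bmeas sub] by simp_all
  note i = bmeas_pair_integrable[OF this(1) sub ab, simplified]
    and j = bmeas_pair_integrable[OF this(2) sub ab, simplified]
  have z': "cnj z = z" using z by (simp add: Reals_cnj_iff)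
  have "set_integrable (var \<rho>) {x..<y} (\<lambda>t. cnj (z * u t + g t))"
    using i(4) unfolding set_integrable_def
    by (subst complex_integrable_cnj[symmetric]) (simp add: complex_cnj_scaleR del: complex_integrable_cnj complex_cnj_add complex_cnj_mult)
  \<comment> \<open>Since \<open>g\<close> is real only almost everywhere for the variation of
    \<rho>, the integrands are exchanged under the integral and not pointwise.\<close>
  then have "cmint \<rho> {x..<y} (\<lambda>t. z * cnj (u t) + g t) = cmint \<rho> {x..<y} (\<lambda>t. cnj (z * u t + g t))"
  proof (intro r.cmint_cong_AE j(4))
    show "AE t in var \<rho>. t \<in> {x..<y} \<longrightarrow> z * cnj (u t) + g t = cnj (z * u t + g t)"
      using g_real by eventually_elim (use sub' z' in \<open>auto simp: Reals_cnj_iff\<close>)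
  qed
  then have "incr {x..<y} (\<lambda>t. (cnj (u t), cnj (w t)))
      = (cnj (fst (incr {x..<y} (\<lambda>t. (u t, w t)))), cnj (snd (incr {x..<y} (\<lambda>t. (u t, w t)))))"
    using s.cmint_cnj[OF re(2) ival i(1)] k.cmint_cnj[OF re(3) ival i(2)]
      r.cmint_cnj[OF re(1) ival i(4)] by (simp add: incr_def)
  then show "(cnj (u y), cnj (w y)) = (cnj (u x), cnj (w x)) + incr {x..<y} (\<lambda>t. (cnj (u t), cnj (w t)))"
    using solD(2)[OF sol xy] by (auto simp: prod_eq_iff)
qed

end

section \<open>Well-posedness of all initial value problems and reality of solutions\<close>

theorem theorem3p1:
  fixes a b :: ereal and \<rho> \<sigma> \<kappa> :: cmeas and g :: "real \<Rightarrow> complex"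
  assumes "a < b"
    and "loc_finite_cmeasure a b \<rho>" "loc_finite_cmeasure a b \<sigma>" "loc_finite_cmeasure a b \<kappa>"
    and "full_support a b \<sigma>"
    and "L1loc a b \<rho> g"
  shows "((\<forall>z c d1 d2. c \<in> ival a b \<longrightarrow>
             (\<exists>u. ivp_solution a b \<rho> \<sigma> \<kappa> g z c d1 d2 u \<and>
                  (\<forall>v. ivp_solution a b \<rho> \<sigma> \<kappa> g z c d1 d2 v \<longrightarrow> (\<forall>x\<in>ival a b. v x = u x))))
          \<longleftrightarrow>
          (\<forall>x\<in>ival a b. cmeasure \<rho> {x} * cmeasure \<sigma> {x} = 0 \<and>
                         cmeasure \<kappa> {x} * cmeasure \<sigma> {x} \<noteq> 1))
       \<and>
         ((\<forall>x\<in>ival a b. cmeasure \<rho> {x} * cmeasure \<sigma> {x} = 0 \<and>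
                         cmeasure \<kappa> {x} * cmeasure \<sigma> {x} \<noteq> 1) \<longrightarrow>
          real_cmeasure a b \<rho> \<longrightarrow> real_cmeasure a b \<sigma> \<longrightarrow> real_cmeasure a b \<kappa> \<longrightarrow>
          (AE x in var \<rho>. x \<in> ival a b \<longrightarrow> g x \<in> \<real>) \<longrightarrow>
          (\<forall>z c d1 d2 u. z \<in> \<real> \<longrightarrow> c \<in> ival a b \<longrightarrow> d1 \<in> \<real> \<longrightarrow> d2 \<in> \<real> \<longrightarrow>
             ivp_solution a b \<rho> \<sigma> \<kappa> g z c d1 d2 u \<longrightarrow> (\<forall>x\<in>ival a b. u x \<in> \<real>)))"
    (is "(?wellposed \<longleftrightarrow> ?cond) \<and> (?cond \<longrightarrow> ?real)")
proof -
  \<comment> \<open>This fact does not involve \<open>z\<close>, so it serves every value of the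
    spectral parameter.\<close>
  have sl: "sturm_liouville a b \<rho> \<sigma> \<kappa> g"
    using assms by unfold_locales
  have necessary: ?cond if wp: ?wellposed
  proof -
    have regular: "cmeasure \<sigma> {x} * (cmeasure \<kappa> {x} - z * cmeasure \<rho> {x}) \<noteq> 1"
      if x: "x \<in> ival a b" for x z
    proof
      interpret sturm_liouville a b \<rho> \<sigma> \<kappa> g z by (rule sl)
      assume sing: "cmeasure \<sigma> {x} * (cmeasure \<kappa> {x} - z * cmeasure \<rho> {x}) = 1"
      have "\<exists>u. ivp_solution a b \<rho> \<sigma> \<kappa> g z x d1 d2 u" for d1 d2 using wp x by blast
      then obtain c d1 d2 u v where "c \<in> ival a b" "ivp_solution a b \<rho> \<sigma> \<kappa> g z c d1 d2 u"
        "ivp_solution a b \<rho> \<sigma> \<kappa> g z c d1 d2 v" "u x \<noteq> v x"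
        by (rule singular_jump_nonunique[OF x sing])
      then show False using wp x by metis
    qed
    show ?cond
    proof (intro ballI conjI)
      fix x assume x: "x \<in> ival a b"
      show "cmeasure \<kappa> {x} * cmeasure \<sigma> {x} \<noteq> 1"
        using regular[OF x, of 0] by (simp add: mult.commute)
      show "cmeasure \<rho> {x} * cmeasure \<sigma> {x} = 0"
      proof (rule ccontr)
        assume "cmeasure \<rho> {x} * cmeasure \<sigma> {x} \<noteq> 0"
        \<comment> \<open>If both masses are nonzero, the determinant is a nonconstant affine
          function of \<open>z\<close>; the value inserted here is its zero.\<close>
        then show False
          using regular[OF x, of "(cmeasure \<kappa> {x} * cmeasure \<sigma> {x} - 1) / (cmeasure \<rho> {x} * cmeasure \<sigma> {x})"]
          by (simp add: field_simps)
      qed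
    qed
  qed
  have sufficient: ?wellposed if cond: ?cond
  proof (intro allI impI)
    fix z c d1 d2 assume c: "c \<in> ival a b"
    interpret sturm_liouville a b \<rho> \<sigma> \<kappa> g z by (rule sl)
    have reg: regular using cond bij_jump unfolding regular_def by blast
    obtain f where f: "global_sol f" "f c = (d1, d2)" by (rule global_sol_exists[OF reg c])
    have "ivp_solution a b \<rho> \<sigma> \<kappa> g z c d1 d2 (\<lambda>t. fst (f t))"
      using global_sol_imp_ivp_solution[OF c, of "\<lambda>t. fst (f t)" "\<lambda>t. snd (f t)"] f by simp
    moreover have "v x = fst (f x)"
      if v: "ivp_solution a b \<rho> \<sigma> \<kappa> g z c d1 d2 v" and x: "x \<in> ival a b" for v x
    proof -
      obtain w where "global_sol (\<lambda>t. (v t, w t))" "v c = d1" "w c = d2"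
        by (rule ivp_solution_imp_global_sol[OF c v])
      then show ?thesis using global_sol_unique[OF reg _ f(1) c _ x, of "\<lambda>t. (v t, w t)"] f(2)
        by (simp add: prod_eq_iff)
    qed
    ultimately show "\<exists>u. ivp_solution a b \<rho> \<sigma> \<kappa> g z c d1 d2 u \<and>
        (\<forall>v. ivp_solution a b \<rho> \<sigma> \<kappa> g z c d1 d2 v \<longrightarrow> (\<forall>x\<in>ival a b. v x = u x))" by blast
  qed
  have real: ?real if cond: ?cond
  proof (intro impI allI ballI)
    fix z c d1 d2 u x
    assume re: "real_cmeasure a b \<rho>" "real_cmeasure a b \<sigma>" "real_cmeasure a b \<kappa>"
      "AE x in var \<rho>. x \<in> ival a b \<longrightarrow> g x \<in> \<real>"
      and z: "z \<in> \<real>" and c: "c \<in> ival a b" and d: "d1 \<in> \<real>" "d2 \<in> \<real>"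
      and u: "ivp_solution a b \<rho> \<sigma> \<kappa> g z c d1 d2 u" and x: "x \<in> ival a b"
    interpret sturm_liouville a b \<rho> \<sigma> \<kappa> g z by (rule sl)
    have reg: regular using cond bij_jump unfolding regular_def by blast
    obtain w where w: "global_sol (\<lambda>t. (u t, w t))" "u c = d1" "w c = d2"
      by (rule ivp_solution_imp_global_sol[OF c u])
    \<comment> \<open>As \<open>d1\<close> and \<open>d2\<close> are real, the solution and its
      conjugate agree at \<open>c\<close>, hence everywhere by uniqueness.\<close>
    have "(u x, w x) = (cnj (u x), cnj (w x))"
      using global_sol_unique[OF reg w(1) global_sol_cnj[OF re z w(1)] c _ x] w d by (simp add: Reals_cnj_iff)
    then show "u x \<in> \<real>" by (simp add: Reals_cnj_iff)
  qed
  show ?thesis by (rule conjI[OF iffI[OF necessary sufficient] impI[OF real]])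
qed

end
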